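(* Assume that $u\in W^{1,1}_{\rm loc}(\mathbb R^n)$ is such that $$|\{|u|>t\}|<\infty\qquad\text{for }t>0,$$ and $$\int_{\mathbb R^n\setminus B(0,1)}\frac{|\nabla u(x)|}{|x|^{n-1}}\,dx<\infty.$$ Then $$u(x)=\frac1{n\omega_n}\int_{\mathbb R^n}\frac{\nabla u(y)\cdot(x-y)}{|x-y|^n}\,dy\qquad\text{for a.e. }x\in\mathbb R^n.$$
   Context: $|E|$ denotes the Lebesgue measure of $E$, $B(0,1)$ is the unit ball of $\mathbb R^n$ centered at the origin, $\omega_n$ is the Lebesgue measure of the unit ball in $\mathbb R^n$, and the dot denotes the scalar product in $\mathbb R^n$. *)

theory Defs
  imports "HOL-Analysis.Analysis"
begin

text \<open>Being of class C^k on the whole space: differentiable with all partial derivatives of class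
  C^(k-1). \<open>frechet_derivative\<close> is unspecified where there is no derivative, hence the
  explicit differentiability requirement.\<close>

primrec Ck :: "nat \<Rightarrow> ('a::euclidean_space \<Rightarrow> real) \<Rightarrow> bool" where
  "Ck 0 f \<longleftrightarrow> continuous_on UNIV f"
| "Ck (Suc k) f \<longleftrightarrow> (\<forall>x. f differentiable (at x)) \<and>
     (\<forall>i\<in>Basis. Ck k (\<lambda>x. frechet_derivative f (at x) i))"

definition test_fun :: "('a::euclidean_space \<Rightarrow> real) \<Rightarrow> bool" where
  "test_fun \<phi> \<longleftrightarrow> (\<forall>k. Ck k \<phi>) \<and> compact (closure {x. \<phi> x \<noteq> 0})"

definition loc_integrable ::
  "('a::euclidean_space \<Rightarrow> 'b::euclidean_space) \<Rightarrow> bool" where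
  "loc_integrable f \<longleftrightarrow> (\<forall>K. compact K \<longrightarrow> set_integrable lebesgue K f)"

text \<open>The weak gradient is unique only up to null sets, so it is a relation rather than a
  function. Integration is with respect to \<^const>\<open>lebesgue\<close>, so that functions
  need only be Lebesgue (not Borel) measurable.\<close>

definition has_weak_gradient ::
  "('a::euclidean_space \<Rightarrow> real) \<Rightarrow> ('a \<Rightarrow> 'a) \<Rightarrow> bool" where
  "has_weak_gradient u g \<longleftrightarrow> loc_integrable u \<and> loc_integrable g \<and>
     (\<forall>\<phi>. test_fun \<phi> \<longrightarrow> (\<forall>i\<in>Basis.
        (LINT x|lebesgue. u x * frechet_derivative \<phi> (at x) i) =
        - (LINT x|lebesgue. (g x \<bullet> i) * \<phi> x)))"

definition W11_loc :: "('a::euclidean_space \<Rightarrow> real) set" where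
  "W11_loc = {u. loc_integrable u \<and> (\<exists>g. has_weak_gradient u g)}"

end

theory Submission
  imports Defs
begin

text \<open>
  The idea is to integrate the gradient along rays that leave \<open>x\<close>, and to average over the rays.

  Write \<open>n\<close> for the dimension and \<open>B\<close> for the unit ball.  For a fixed vector \<open>v\<close>, almost every \<open>x\<close>
  satisfies \<open>u (x + v) - u x = \<integral> Du (x + r v) \<bullet> v dr\<close>, integrated over \<open>0 \<le> r \<le> 1\<close>; this follows
  directly from the definition of the weak gradient by testing and Fubini
  (\<open>weak_gradient_difference\<close>).  Applied to \<open>2 ^ i v\<close> for all \<open>i\<close>, it says that for almost every \<open>x\<close> and
  almost every \<open>v\<close> the values \<open>u (x + 2 ^ i v)\<close> are obtained from \<open>u x\<close> by integrating
  \<open>Du (x + r v) \<bullet> v\<close> over \<open>0 \<le> r \<le> 2 ^ i\<close>.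

  The growth hypothesis on the gradient makes \<open>\<integral> norm (Du y) / norm (x - y) ^ (n - 1) dy\<close>
  finite for almost every \<open>x\<close> (\<open>AE_integrable_riesz_potential\<close>).  For such \<open>x\<close> the function
  \<open>r \<mapsto> Du (x + r v) \<bullet> v\<close> is integrable over all \<open>r > 0\<close> for almost every \<open>v \<in> B\<close>, so \<open>u (x + 2 ^ i v)\<close>
  converges as \<open>i\<close> grows.  The set of \<open>v \<in> B\<close> with \<open>\<bar>u (x + 2 ^ i v)\<bar> > t\<close> has measure at
  most \<open>2 ^ (- i n)\<close> times the finite measure of \<open>{\<bar>u\<bar> > t}\<close>, so the limit is 0 for almost
  every \<open>v\<close> (\<open>AE_dyadic_dilation_limit_zero\<close>).  Hence \<open>u x\<close> is minus the integral of
  \<open>Du (x + r v) \<bullet> v\<close> over \<open>r > 0\<close>.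

  It remains to integrate over \<open>v \<in> B\<close>.  The substitution \<open>w = r v\<close> transforms the measure
  \<open>dv dr / r\<close> into \<open>dw / (n * norm w ^ n)\<close> (\<open>distr_ray_measure\<close>), and \<open>u x\<close> times the
  volume of \<open>B\<close> becomes the integral of \<open>- Du (x + w) \<bullet> w / (n * norm w ^ n)\<close>.  With \<open>y = x + w\<close> this
  is the assertion.
\<close>

section \<open>Smooth bump functions\<close>

text \<open>The classical smooth function that is flat at the origin, together with its
  multiples by negative powers of \<open>t\<close>: the family is closed under differentiation up to linear
  combinations, which is what makes smoothness an induction.  The parameter \<open>c\<close> is there because
  \<open>flat c 0\<close> increases to the indicator of the positive reals as \<open>c\<close> decreases to 0.\<close>

definition flat :: "real \<Rightarrow> nat \<Rightarrow> real \<Rightarrow> real" where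
  "flat c m t = (if t > 0 then exp (- c / t) / t ^ m else 0)"

lemma flat_tendsto_0:
  assumes "c > 0"
  shows "(flat c m \<longlongrightarrow> 0) (at 0)"
proof -
  have "((\<lambda>s. s ^ m * exp (- (c * s))) \<longlongrightarrow> 0) at_top"
  proof -
    have "((\<lambda>s. (1 / c ^ m) * ((c * s) ^ m / exp (c * s))) \<longlongrightarrow> (1 / c ^ m) * 0) at_top"
      by (intro tendsto_mult tendsto_const filterlim_compose[OF tendsto_power_div_exp_0]
            filterlim_tendsto_pos_mult_at_top[OF tendsto_const assms] filterlim_ident)
    then show ?thesis
      using assms by (simp add: power_mult_distrib exp_minus divide_simps)
  qed
  then have "((\<lambda>t. (inverse t) ^ m * exp (- (c * inverse t))) \<longlongrightarrow> 0) (at_right 0)"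
    by (rule filterlim_compose) (rule filterlim_inverse_at_top_right)
  moreover have "eventually (\<lambda>t. (inverse t) ^ m * exp (- (c * inverse t)) = flat c m t) (at_right 0)"
    using eventually_at_right_less[of "0::real"]
    by (rule eventually_mono) (simp add: flat_def inverse_eq_divide power_one_over)
  ultimately have R: "(flat c m \<longlongrightarrow> 0) (at_right 0)"
    by (rule Lim_transform_eventually)
  have "eventually (\<lambda>t. 0 = flat c m t) (at_left 0)"
    by (auto simp: eventually_at_filter flat_def)
  then have L: "(flat c m \<longlongrightarrow> 0) (at_left 0)"
    by (rule Lim_transform_eventually[OF tendsto_const])
  from L R show ?thesis by (rule filterlim_split_at)
qed

lemma has_real_derivative_flat:
  assumes "c > 0"
  shows "(flat c m has_real_derivative (c * flat c (m + 2) t - m * flat c (m + 1) t)) (at t)"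
proof -
  consider "t > 0" | "t < 0" | "t = 0" by linarith
  then show ?thesis
  proof cases
    case 1
    have E: "((\<lambda>s. exp (- c / s)) has_real_derivative exp (- c / t) * (c / t ^ 2)) (at t)"
      using 1 by (auto intro!: derivative_eq_intros simp: power2_eq_square)
    have "((\<lambda>s. exp (- c / s) / s ^ m) has_real_derivative
       (exp (- c / t) * (c / t ^ 2) * t ^ m - exp (- c / t) * (real m * t ^ (m - 1))) / (t ^ m * t ^ m)) (at t)"
      using 1 by (intro DERIV_divide E) (auto intro!: derivative_eq_intros)
    also have "(exp (- c / t) * (c / t ^ 2) * t ^ m - exp (- c / t) * (real m * t ^ (m - 1))) / (t ^ m * t ^ m)
       = c * flat c (m + 2) t - m * flat c (m + 1) t"
      using 1 by (cases m) (simp_all add: flat_def field_simps power2_eq_square)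
    finally have "((\<lambda>s. exp (- c / s) / s ^ m) has_real_derivative (c * flat c (m + 2) t - m * flat c (m + 1) t)) (at t)" .
    moreover have ev: "eventually (\<lambda>s. exp (- c / s) / s ^ m = flat c m s) (nhds t)"
      using eventually_nhds_in_open[of "{0<..}" t] 1 by (auto simp: flat_def elim!: eventually_mono)
    ultimately show ?thesis by (simp only: DERIV_cong_ev[OF refl ev refl])
  next
    case 2
    have ev: "eventually (\<lambda>s. 0 = flat c m s) (nhds t)"
      using eventually_nhds_in_open[of "{..<0}" t] 2 by (auto simp: flat_def elim!: eventually_mono)
    moreover have "((\<lambda>s. 0) has_real_derivative (c * flat c (m + 2) t - m * flat c (m + 1) t)) (at t)"
      using 2 by (simp add: flat_def)
    ultimately show ?thesis by (simp only: DERIV_cong_ev[OF refl ev refl])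
  next
    case 3
    have "(\<lambda>h. flat c m h / h) = flat c (m + 1)"
      by (auto simp: flat_def fun_eq_iff)
    then show ?thesis
      using flat_tendsto_0[OF assms, of "m + 1"] 3
      by (simp add: DERIV_def flat_def)
  qed
qed

lemma Ck_const: "Ck k (\<lambda>x. c)"
  by (induction k arbitrary: c) (auto simp: frechet_derivative_const)

lemma Ck_add: "Ck k f \<Longrightarrow> Ck k g \<Longrightarrow> Ck k (\<lambda>x. f x + g x)"
proof (induction k arbitrary: f g)
  case 0
  then show ?case by (auto intro: continuous_on_add)
next
  case (Suc k)
  then have "frechet_derivative (\<lambda>x. f x + g x) (at x) = (\<lambda>h. frechet_derivative f (at x) h + frechet_derivative g (at x) h)" for x
    by (intro frechet_derivative_at[symmetric] has_derivative_add) (auto simp: frechet_derivative_works)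
  with Suc show ?case by auto
qed

lemma Ck_SucD: "Ck (Suc k) f \<Longrightarrow> Ck k f"
proof (induction k arbitrary: f)
  case 0
  then show ?case
    by (auto intro!: continuous_at_imp_continuous_on simp: differentiable_imp_continuous_within)
next
  case (Suc k)
  from Suc.prems have "\<forall>x. f differentiable (at x)"
    "\<forall>i\<in>Basis. Ck (Suc k) (\<lambda>x. frechet_derivative f (at x) i)"
    unfolding Ck.simps(2)[of "Suc k" f] by auto
  then show ?case using Suc.IH unfolding Ck.simps(2)[of k f] by blast
qed

lemma Ck_mult: "Ck k f \<Longrightarrow> Ck k g \<Longrightarrow> Ck k (\<lambda>x. f x * g x)"
proof (induction k arbitrary: f g)
  case 0
  then show ?case by (auto intro: continuous_on_mult)
next
  case (Suc k)
  have "frechet_derivative (\<lambda>x. f x * g x) (at x) =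
      (\<lambda>h. f x * frechet_derivative g (at x) h + frechet_derivative f (at x) h * g x)" for x
    using Suc.prems by (intro frechet_derivative_at[symmetric] has_derivative_mult) (auto simp: frechet_derivative_works)
  moreover note Ck_SucD[OF Suc.prems(1)] Ck_SucD[OF Suc.prems(2)]
  ultimately show ?case using Suc by (auto intro!: Ck_add differentiable_mult)
qed

lemma Ck_prod: "finite I \<Longrightarrow> (\<And>i. i \<in> I \<Longrightarrow> Ck k (f i)) \<Longrightarrow> Ck k (\<lambda>x. \<Prod>i\<in>I. f i x)"
  by (induction I rule: finite_induct) (auto intro: Ck_const Ck_mult)

text \<open>Differentiation replaces the exponent \<open>m\<close> by \<open>m + 2\<close> and \<open>m + 1\<close>, so the induction on the
  order of smoothness has to treat all exponents at once.\<close>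

lemma Ck_flat:
  assumes "c > 0"
  shows "Ck k (\<lambda>x::'a::euclidean_space. flat c m (x \<bullet> w + d))"
proof (induction k arbitrary: m)
  case 0
  have "isCont (flat c m) t" for t
    using has_real_derivative_flat[OF assms] DERIV_isCont by blast
  then show ?case
    by (auto intro!: continuous_at_imp_continuous_on continuous_intros isCont_o2[of _ "\<lambda>x. x \<bullet> w + d" "flat c m"])
next
  case (Suc k)
  have D: "((\<lambda>x::'a. flat c m (x \<bullet> w + d)) has_derivative
       (\<lambda>h. (h \<bullet> w) * (c * flat c (m + 2) (x \<bullet> w + d) - m * flat c (m + 1) (x \<bullet> w + d)))) (at x)" for x
    by (rule has_derivative_eq_rhs[OF has_derivative_compose[OF _ has_real_derivative_flat[OF assms, THEN has_field_derivative_imp_has_derivative]]])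
       (auto intro!: derivative_eq_intros)
  have "frechet_derivative (\<lambda>x::'a. flat c m (x \<bullet> w + d)) (at x) =
     (\<lambda>h. (h \<bullet> w * c) * flat c (m + 2) (x \<bullet> w + d) + (h \<bullet> w * - real m) * flat c (m + 1) (x \<bullet> w + d))" for x
    by (subst frechet_derivative_at[OF D, symmetric]) (simp add: algebra_simps)
  then show ?case
    unfolding Ck.simps using D Suc
    by (intro conjI allI ballI) (auto simp only: differentiable_def intro!: Ck_add Ck_mult Ck_const)
qed

text \<open>A smooth substitute for the indicator of \<open>box a b\<close>: each coordinate contributes two
  factors, and each of them vanishes beyond one of the two faces orthogonal to that coordinate.\<close>

definition bump :: "real \<Rightarrow> 'a::euclidean_space \<Rightarrow> 'a \<Rightarrow> 'a \<Rightarrow> real" where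
  "bump c a b x = (\<Prod>i\<in>Basis. flat c 0 (x \<bullet> i + - (a \<bullet> i)) * flat c 0 (x \<bullet> (- i) + b \<bullet> i))"

lemma flat_bounds: "c > 0 \<Longrightarrow> flat c 0 t \<in> {0..1}"
  by (auto simp: flat_def)

lemma bump_bounded:
  assumes "c > 0"
  shows "\<bar>bump c a b x\<bar> \<le> indicator (cbox a b) x"
proof (cases "x \<in> cbox a b")
  case True
  have "bump c a b x \<le> 1" "bump c a b x \<ge> 0"
    unfolding bump_def using flat_bounds[OF assms]
    by (auto intro!: prod_le_1 prod_nonneg mult_le_one)
  then show ?thesis using True by simp
next
  case False
  then obtain i where "i \<in> Basis" "x \<bullet> i < a \<bullet> i \<or> b \<bullet> i < x \<bullet> i" by (auto simp: cbox_def not_le)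
  then have "bump c a b x = 0" unfolding bump_def
    by (intro prod_zero) (auto simp: flat_def intro!: bexI[of _ i])
  then show ?thesis by simp
qed

lemma test_fun_bump:
  assumes "c > 0"
  shows "test_fun (bump c a b)"
proof -
  have "Ck k (bump c a b)" for k
    unfolding bump_def[abs_def]
    by (intro Ck_prod Ck_mult Ck_flat assms finite_Basis)
  moreover have "closure {x. bump c a b x \<noteq> 0} \<subseteq> cbox a b"
  proof (intro closure_minimal closed_cbox subsetI)
    fix x assume "x \<in> {x. bump c a b x \<noteq> 0}"
    then show "x \<in> cbox a b"
      using bump_bounded[OF assms, of a b x] by (cases "x \<in> cbox a b") auto
  qed
  ultimately show ?thesis
    unfolding test_fun_def by (metis compact_cbox compact_Int_closed closed_closure inf.absorb_iff2)
qed

lemma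
  fixes a :: "'a::euclidean_space"
  shows Ck_translate: "Ck k f \<Longrightarrow> Ck k (\<lambda>x. f (x - a))"
  and frechet_derivative_translate: "(\<And>x. f differentiable (at x)) \<Longrightarrow>
    frechet_derivative (\<lambda>x. f (x - a)) (at x) = frechet_derivative f (at (x - a))"
proof -
  have D: "((\<lambda>x. f (x - a)) has_derivative frechet_derivative f (at (x - a))) (at x)"
    if "\<And>x. f differentiable (at x)" for f :: "'a \<Rightarrow> real" and x
    by (rule has_derivative_eq_rhs[OF has_derivative_compose[OF _ iffD1[OF frechet_derivative_works that]]])
       (auto intro!: derivative_eq_intros)
  show E: "frechet_derivative (\<lambda>x. f (x - a)) (at x) = frechet_derivative f (at (x - a))"
    if "\<And>x. f differentiable (at x)" for f :: "'a \<Rightarrow> real" and x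
    using frechet_derivative_at[OF D[OF that]] by simp
  show "Ck k f \<Longrightarrow> Ck k (\<lambda>x. f (x - a))"
  proof (induction k arbitrary: f)
    case 0
    then show ?case by (auto intro!: continuous_intros continuous_on_compose2[of UNIV f])
  next
    case (Suc k)
    have "\<And>x. f differentiable (at x)" using Suc.prems by simp
    note E[OF this] D[OF this]
    moreover have "Ck k (\<lambda>x. frechet_derivative f (at (x - a)) i)" if "i \<in> Basis" for i
      using Suc.IH[of "\<lambda>x. frechet_derivative f (at x) i"] Suc.prems that by simp
    ultimately show ?case by (auto simp: differentiable_def)
  qed
qed

lemma test_fun_translate: "test_fun f \<Longrightarrow> test_fun (\<lambda>x. f (x - a))"
proof -
  assume f: "test_fun f"
  have "{x. f (x - a) \<noteq> 0} = (+) a ` {x. f x \<noteq> 0}"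
    by (auto simp: image_iff intro!: exI[of _ "_ - a"])
  then have "closure {x. f (x - a) \<noteq> 0} = (+) a ` closure {x. f x \<noteq> 0}"
    by (simp add: closure_translation)
  then show ?thesis
    using f unfolding test_fun_def by (auto intro: Ck_translate compact_translation)
qed

lemma bump_tendsto_indicator:
  "(\<lambda>n. bump (1 / real (Suc n)) a b x) \<longlonglongrightarrow> indicator (box a b) x"
proof -
  have flat: "(\<lambda>n. flat (1 / real (Suc n)) 0 t) \<longlonglongrightarrow> indicator {0<..} t" for t
  proof (cases "t > 0")
    case True
    have "(\<lambda>n. exp (- (1 / real (Suc n)) / t)) \<longlonglongrightarrow> exp (- 0 / t)"
      using LIMSEQ_inverse_real_of_nat True
      by (intro tendsto_intros) (auto simp: inverse_eq_divide)
    then show ?thesis using True by (simp add: flat_def)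
  qed (simp add: flat_def)
  have "(indicator (box a b) x :: real) = (\<Prod>i\<in>Basis. indicator {0<..} (x \<bullet> i + - (a \<bullet> i)) * indicator {0<..} (x \<bullet> (- i) + b \<bullet> i))"
    by (auto simp: indicator_def box_def intro!: prod_zero)
  then show ?thesis unfolding bump_def by (simp only:) (intro tendsto_prod tendsto_mult flat)
qed

section \<open>The fundamental lemma of the calculus of variations\<close>

text \<open>Bumps converge boundedly to indicators
  of open boxes, so \<open>f\<close> has integral 0 over every box.  Hence the measures whose densities are the
  positive and the negative part of \<open>f\<close> agree on boxes, which form an intersection-stable generator
  of the Borel sets, and so the two densities agree almost everywhere.\<close>

lemma AE_eq_0_if_integrals_test_fun_0:
  fixes f :: "'a::euclidean_space \<Rightarrow> real"
  assumes f[measurable]: "f \<in> borel_measurable borel"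
    and int: "\<And>a b. set_integrable lborel (cbox a b) f"
    and zero: "\<And>\<phi>. test_fun \<phi> \<Longrightarrow> (LINT x|lborel. f x * \<phi> x) = 0"
  shows "AE x in lborel. f x = 0"
proof -
  have int': "integrable lborel (\<lambda>x. indicator (box a b) x * f x)" for a b
    using set_integrable_subset[OF int[of a b], of "box a b"] box_subset_cbox[of a b]
    by (simp add: set_integrable_def)
  have meas: "bump (1 / real (Suc n)) a b \<in> borel_measurable borel" for n and a b :: 'a
  proof -
    have "Ck 0 (bump (1 / real (Suc n)) a b)"
      using test_fun_bump[of "1 / real (Suc n)" a b] unfolding test_fun_def by simp
    then show ?thesis by (auto intro: borel_measurable_continuous_onI)
  qed
  have box0: "(LINT x|lborel. indicator (box a b) x * f x) = 0" for a b
  proof -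
    have "(\<lambda>n. LINT x|lborel. f x * bump (1 / real (Suc n)) a b x) \<longlonglongrightarrow> (LINT x|lborel. f x * indicator (box a b) x)"
    proof (rule integral_dominated_convergence[where w="\<lambda>x. indicator (cbox a b) x * \<bar>f x\<bar>"])
      show "integrable lborel (\<lambda>x. indicator (cbox a b) x * \<bar>f x\<bar>)"
        using set_integrable_abs[OF int[of a b]] by (simp add: set_integrable_def)
      show "AE x in lborel. (\<lambda>n. f x * bump (1 / real (Suc n)) a b x) \<longlonglongrightarrow> f x * indicator (box a b) x"
        by (intro AE_I2 tendsto_mult tendsto_const bump_tendsto_indicator)
      show "AE x in lborel. norm (f x * bump (1 / real (Suc n)) a b x) \<le> indicator (cbox a b) x * \<bar>f x\<bar>" for n
        using mult_right_mono[OF bump_bounded[of "1 / real (Suc n)" a b]]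
        by (intro AE_I2) (auto simp: abs_mult mult.commute)
    qed (use meas in auto)
    moreover have "(LINT x|lborel. f x * bump (1 / real (Suc n)) a b x) = 0" for n
      by (rule zero) (simp add: test_fun_bump)
    ultimately show ?thesis
      by (simp add: LIMSEQ_const_iff mult.commute)
  qed
  \<comment> \<open>\<open>ennreal\<close> truncates at 0, so these densities are the positive and the negative part.\<close>
  let ?P = "density lborel (\<lambda>x. ennreal (f x))" and ?N = "density lborel (\<lambda>x. ennreal (- f x))"
  have eq: "emeasure ?P (box a b) = emeasure ?N (box a b)"
    and fin: "emeasure ?P (box a b) \<noteq> \<infinity>" for a b
  proof -
    let ?g = "\<lambda>x. indicator (box a b) x * f x"
    have P: "emeasure ?P (box a b) = (\<integral>\<^sup>+x. ennreal (?g x) \<partial>lborel)"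
      by (subst emeasure_density) (auto intro!: nn_integral_cong simp: indicator_def)
    have N: "emeasure ?N (box a b) = (\<integral>\<^sup>+x. ennreal (- ?g x) \<partial>lborel)"
      by (subst emeasure_density) (auto intro!: nn_integral_cong simp: indicator_def)
    have *: "(\<integral>\<^sup>+x. ennreal (?g x) \<partial>lborel) \<noteq> \<infinity>" "(\<integral>\<^sup>+x. ennreal (- ?g x) \<partial>lborel) \<noteq> \<infinity>"
      using int'[of a b] unfolding real_integrable_def by auto
    have enn2real_inj: "p = q" if "enn2real p = enn2real q" "p \<noteq> \<infinity>" "q \<noteq> \<infinity>" for p q
      using that by (cases p; cases q) auto
    have "enn2real (\<integral>\<^sup>+x. ennreal (?g x) \<partial>lborel) = enn2real (\<integral>\<^sup>+x. ennreal (- ?g x) \<partial>lborel)"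
      using box0[of a b] real_lebesgue_integral_def[OF int'[of a b]] by simp
    then show "emeasure ?P (box a b) = emeasure ?N (box a b)"
      unfolding P N using * by (rule enn2real_inj)
    show "emeasure ?P (box a b) \<noteq> \<infinity>" using *(1) unfolding P .
  qed
  have "?P = ?N"
  proof (rule measure_eqI_generator_eq)
    let ?E = "range (\<lambda>(a, b). box a b::'a set)"
    show "Int_stable ?E"
      by (auto simp: Int_stable_def box_Int_box)
    show "?E \<subseteq> Pow UNIV" "sets ?P = sigma_sets UNIV ?E" "sets ?N = sigma_sets UNIV ?E"
      by (simp_all add: borel_eq_box)
    let ?A = "\<lambda>n::nat. box (- (real n *\<^sub>R One)) (real n *\<^sub>R One) :: 'a set"
    show "range ?A \<subseteq> ?E" "(\<Union>i. ?A i) = UNIV"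
      unfolding UN_box_eq_UNIV by auto
    show "emeasure ?P (?A i) \<noteq> \<infinity>" for i by (rule fin)
    show "emeasure ?P X = emeasure ?N X" if "X \<in> ?E" for X
      using that eq by auto
  qed
  then have "AE x in lborel. ennreal (f x) = ennreal (- f x)"
    by (subst (asm) sigma_finite_measure.density_unique_iff[OF sigma_finite_lborel]) auto
  moreover have "f x = 0" if "ennreal (f x) = ennreal (- f x)" for x
    using that by (cases "f x \<ge> 0") (simp_all add: ennreal_neg ennreal_eq_0_iff)
  ultimately show ?thesis by (auto elim: eventually_mono)
qed

section \<open>Test functions and directional weak derivatives\<close>

lemma test_fun_continuous: "test_fun \<phi> \<Longrightarrow> continuous_on UNIV \<phi>"
  and test_fun_differentiable: "test_fun \<phi> \<Longrightarrow> \<phi> differentiable (at x)"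
proof -
  assume "test_fun \<phi>"
  then have "Ck 0 \<phi>" "Ck (Suc 0) \<phi>" unfolding test_fun_def by blast+
  then show "continuous_on UNIV \<phi>" "\<phi> differentiable (at x)" by auto
qed

lemma test_fun_measurable: "test_fun \<phi> \<Longrightarrow> \<phi> \<in> borel_measurable borel"
  by (intro borel_measurable_continuous_onI test_fun_continuous)

lemma test_fun_bounded:
  assumes "test_fun \<phi>"
  shows "\<exists>C\<ge>0. \<exists>\<rho>. \<forall>x. \<bar>\<phi> x\<bar> \<le> C * indicator (cball 0 \<rho>) x"
proof -
  let ?S = "closure {x. \<phi> x \<noteq> 0}"
  have c: "compact ?S" using assms by (simp add: test_fun_def)
  then obtain \<rho> where \<rho>: "\<rho> > 0" "\<And>x. x \<in> ?S \<Longrightarrow> norm x \<le> \<rho>"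
    using compact_imp_bounded bounded_pos by metis
  have "compact (\<phi> ` ?S)"
    using test_fun_continuous[OF assms] c by (meson compact_continuous_image continuous_on_subset subset_UNIV)
  then obtain C where C: "C > 0" "\<And>y. y \<in> \<phi> ` ?S \<Longrightarrow> norm y \<le> C"
    using compact_imp_bounded bounded_pos by metis
  have "\<bar>\<phi> x\<bar> \<le> C * indicator (cball 0 \<rho>) x" for x
  proof (cases "x \<in> ?S")
    case True
    then show ?thesis using C(2)[of "\<phi> x"] \<rho>(2)[of x] by simp
  next
    case False
    then have "\<phi> x = 0" using closure_subset[of "{x. \<phi> x \<noteq> 0}"] by auto
    then show ?thesis using C by simp
  qed
  then show ?thesis using less_imp_le[OF C(1)] by blast
qed

lemma frechet_derivative_eq_sum_Basis:
  fixes \<phi> :: "'a::euclidean_space \<Rightarrow> real"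
  assumes "\<phi> differentiable (at x)"
  shows "frechet_derivative \<phi> (at x) v = (\<Sum>i\<in>Basis. (v \<bullet> i) * frechet_derivative \<phi> (at x) i)"
proof -
  have L: "linear (frechet_derivative \<phi> (at x))"
    using assms by (rule linear_frechet_derivative)
  have "frechet_derivative \<phi> (at x) v = frechet_derivative \<phi> (at x) (\<Sum>i\<in>Basis. (v \<bullet> i) *\<^sub>R i)"
    by (simp add: euclidean_representation)
  then show ?thesis
    by (simp add: linear_sum[OF L] linear_cmul[OF L])
qed

lemma test_fun_frechet_derivative:
  fixes \<phi> :: "'a::euclidean_space \<Rightarrow> real"
  assumes "test_fun \<phi>"
  shows "test_fun (\<lambda>x. frechet_derivative \<phi> (at x) v)"
proof -
  let ?S = "closure {x. \<phi> x \<noteq> 0}"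
  have Ck_sum: "Ck k (\<lambda>x. \<Sum>i\<in>I. f i x)" if "finite I" "\<And>i. i \<in> I \<Longrightarrow> Ck k (f i)"
    for k I and f :: "'a \<Rightarrow> 'a \<Rightarrow> real"
    using that by (induction I rule: finite_induct) (auto intro: Ck_const Ck_add)
  have "Ck k (\<lambda>x. frechet_derivative \<phi> (at x) v)" for k
  proof -
    have "Ck (Suc k) \<phi>" using assms unfolding test_fun_def by blast
    then have "Ck k (\<lambda>x. \<Sum>i\<in>Basis. (v \<bullet> i) * frechet_derivative \<phi> (at x) i)"
      by (intro Ck_sum Ck_mult Ck_const) auto
    then show ?thesis
      by (simp only: frechet_derivative_eq_sum_Basis[OF test_fun_differentiable[OF assms], of _ v])
  qed
  moreover have "closure {x. frechet_derivative \<phi> (at x) v \<noteq> 0} \<subseteq> ?S"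
  proof (intro closure_minimal closed_closure subsetI, rule ccontr)
    fix x assume x: "x \<in> {x. frechet_derivative \<phi> (at x) v \<noteq> 0}" "x \<notin> ?S"
    have "(\<phi> has_derivative (\<lambda>_. 0)) (at x)"
    proof (rule has_derivative_transform_within_open[of "\<lambda>_. 0" _ _ _ "- ?S"])
      show "0 = \<phi> y" if "y \<in> - ?S" for y
        using that closure_subset[of "{x. \<phi> x \<noteq> 0}"] by auto
    qed (use x in auto)
    then have "frechet_derivative \<phi> (at x) = (\<lambda>_. 0)"
      using frechet_derivative_at by metis
    with x show False by simp
  qed
  ultimately show ?thesis
    using assms unfolding test_fun_def by (metis compact_Int_closed closed_closure inf.absorb_iff2)
qed

lemma nn_integral_lborel_translate:
  fixes a :: "'a::euclidean_space"
  assumes [measurable]: "f \<in> borel_measurable borel"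
  shows "(\<integral>\<^sup>+x. f (x + a) \<partial>lborel) = (\<integral>\<^sup>+x. f x \<partial>lborel)"
  by (subst (2) lborel_distr_plus[of a, symmetric]) (simp add: nn_integral_distr add.commute)

lemma integral_lborel_translate:
  fixes a :: "'a::euclidean_space" and f :: "'a \<Rightarrow> 'b::{banach, second_countable_topology}"
  assumes [measurable]: "f \<in> borel_measurable borel"
  shows "(LINT x|lborel. f (x + a)) = (LINT x|lborel. f x)"
    and "integrable lborel (\<lambda>x. f (x + a)) \<longleftrightarrow> integrable lborel f"
  by (subst (2) lborel_distr_plus[of a, symmetric], simp add: integral_distr integrable_distr_eq add.commute)+

text \<open>For fixed \<open>r\<close> the map \<open>x \<mapsto> x + r w\<close> preserves Lebesgue measure, so the double integral of the
  majorant is just the integral of \<open>G\<close>.  This justifies every exchange of integrals over a segment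
  parameter and over space.\<close>

lemma integrable_pair_if_bounded_by_shear:
  fixes F :: "'a::euclidean_space \<times> real \<Rightarrow> real"
  assumes F: "F \<in> borel_measurable (lborel \<Otimes>\<^sub>M lborel)"
    and G: "integrable lborel G"
    and le: "\<And>x r. \<bar>F (x, r)\<bar> \<le> indicator {0..1} r * G (x + r *\<^sub>R w)"
  shows "integrable (lborel \<Otimes>\<^sub>M lborel) F"
proof (rule integrableI_bounded)
  have [measurable]: "G \<in> borel_measurable borel" using G by auto
  have "(\<integral>\<^sup>+p. norm (F p) \<partial>(lborel \<Otimes>\<^sub>M lborel)) \<le>
      (\<integral>\<^sup>+p. indicator {0..1} (snd p) * ennreal (G (fst p + snd p *\<^sub>R w)) \<partial>(lborel \<Otimes>\<^sub>M lborel))"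
  proof (rule nn_integral_mono)
    fix p :: "'a \<times> real"
    have "\<bar>F p\<bar> \<le> indicator {0..1} (snd p) * G (fst p + snd p *\<^sub>R w)"
      using le[of "fst p" "snd p"] by simp
    then show "ennreal (norm (F p)) \<le> indicator {0..1} (snd p) * ennreal (G (fst p + snd p *\<^sub>R w))"
      by (auto simp: indicator_def intro!: ennreal_leI split: if_splits)
  qed
  also have "\<dots> = (\<integral>\<^sup>+r. \<integral>\<^sup>+x. indicator {0..1} r * ennreal (G (x + r *\<^sub>R w)) \<partial>lborel \<partial>lborel)"
    by (subst lborel_pair.nn_integral_snd[symmetric]) auto
  also have "\<dots> = (\<integral>\<^sup>+r. indicator {0..1::real} r * (\<integral>\<^sup>+x. ennreal (G x) \<partial>lborel) \<partial>lborel)"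
    by (subst nn_integral_cmult) (auto simp: nn_integral_lborel_translate[of "\<lambda>x. ennreal (G x)"])
  also have "\<dots> = (\<integral>\<^sup>+x. ennreal (G x) \<partial>lborel)"
    by (subst nn_integral_multc) auto
  also have "\<dots> \<le> (\<integral>\<^sup>+x. ennreal (norm (G x)) \<partial>lborel)"
    by (intro nn_integral_mono ennreal_leI) auto
  also have "\<dots> < \<infinity>" using G by (simp add: integrable_iff_bounded)
  finally show "(\<integral>\<^sup>+p. norm (F p) \<partial>(lborel \<Otimes>\<^sub>M lborel)) < \<infinity>" .
qed fact

lemma integrable_mult_test_fun:
  fixes h :: "'a::euclidean_space \<Rightarrow> real"
  assumes [measurable]: "h \<in> borel_measurable borel"
    and h: "\<And>\<rho>. set_integrable lborel (cball 0 \<rho>) h"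
    and \<phi>: "test_fun \<phi>"
  shows "integrable lborel (\<lambda>x. h x * \<phi> x)"
proof -
  note [measurable] = test_fun_measurable[OF \<phi>]
  obtain C \<rho> where C: "C \<ge> 0" "\<And>x. \<bar>\<phi> x\<bar> \<le> C * indicator (cball 0 \<rho>) x"
    using test_fun_bounded[OF \<phi>] by blast
  show ?thesis
  proof (rule Bochner_Integration.integrable_bound)
    show "integrable lborel (\<lambda>x. C * (indicator (cball 0 \<rho>) x *\<^sub>R h x))"
      using h[of \<rho>] unfolding set_integrable_def by (rule integrable_mult_right)
    show "AE x in lborel. norm (h x * \<phi> x) \<le> norm (C * (indicator (cball 0 \<rho>) x *\<^sub>R h x))"
    proof (rule AE_I2)
      fix x
      have "norm (h x * \<phi> x) \<le> \<bar>h x\<bar> * (C * indicator (cball 0 \<rho>) x)"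
        unfolding real_norm_def abs_mult by (intro mult_left_mono C(2)) simp
      also have "\<dots> = norm (C * (indicator (cball 0 \<rho>) x *\<^sub>R h x))"
        using C(1) by (simp add: abs_mult)
      finally show "norm (h x * \<phi> x) \<le> norm (C * (indicator (cball 0 \<rho>) x *\<^sub>R h x))" .
    qed
  qed simp
qed

text \<open>The definition of the weak gradient concerns coordinate directions only; linearity of the
  derivative in the direction gives all others.\<close>

lemma weak_gradient_direction:
  fixes u :: "'a::euclidean_space \<Rightarrow> real" and g :: "'a \<Rightarrow> 'a"
  assumes meas[measurable]: "u \<in> borel_measurable borel" "g \<in> borel_measurable borel"
    and u: "\<And>\<rho>. set_integrable lborel (cball 0 \<rho>) u"
    and g: "\<And>\<rho>. set_integrable lborel (cball 0 \<rho>) g"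
    and weak: "\<And>\<phi> i. test_fun \<phi> \<Longrightarrow> i \<in> Basis \<Longrightarrow>
      (LINT x|lborel. u x * frechet_derivative \<phi> (at x) i) = - (LINT x|lborel. (g x \<bullet> i) * \<phi> x)"
    and \<phi>: "test_fun \<phi>"
  shows "(LINT x|lborel. u x * frechet_derivative \<phi> (at x) v) = - (LINT x|lborel. (g x \<bullet> v) * \<phi> x)"
proof -
  have gi: "set_integrable lborel (cball 0 \<rho>) (\<lambda>x. g x \<bullet> i)" for \<rho> i
    using integrable_inner_left[OF g[unfolded set_integrable_def]]
    unfolding set_integrable_def by simp
  have "(LINT x|lborel. u x * frechet_derivative \<phi> (at x) v) =
      (LINT x|lborel. (\<Sum>i\<in>Basis. (v \<bullet> i) * (u x * frechet_derivative \<phi> (at x) i)))"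
    by (subst frechet_derivative_eq_sum_Basis[OF test_fun_differentiable[OF \<phi>]])
       (simp add: sum_distrib_left mult_ac)
  also have "\<dots> = (\<Sum>i\<in>Basis. (v \<bullet> i) * (LINT x|lborel. u x * frechet_derivative \<phi> (at x) i))"
    by (subst Bochner_Integration.integral_sum)
       (auto intro!: integrable_mult_test_fun u test_fun_frechet_derivative \<phi>)
  also have "\<dots> = - (\<Sum>i\<in>Basis. (v \<bullet> i) * (LINT x|lborel. (g x \<bullet> i) * \<phi> x))"
    by (simp add: weak[OF \<phi>] sum_negf)
  also have "(\<Sum>i\<in>Basis. (v \<bullet> i) * (LINT x|lborel. (g x \<bullet> i) * \<phi> x)) =
      (LINT x|lborel. (\<Sum>i\<in>Basis. (v \<bullet> i) * ((g x \<bullet> i) * \<phi> x)))"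
    by (subst Bochner_Integration.integral_sum)
       (auto intro!: integrable_mult_test_fun gi \<phi>)
  also have "\<dots> = (LINT x|lborel. (g x \<bullet> v) * \<phi> x)"
    by (intro Bochner_Integration.integral_cong refl)
       (subst euclidean_inner, simp add: sum_distrib_left sum_distrib_right mult_ac)
  finally show ?thesis .
qed

lemma test_fun_diff_eq_integral:
  assumes "test_fun \<phi>"
  shows "\<phi> (y - v) - \<phi> y = (LINT r|lborel. indicator {0..1} r * - frechet_derivative \<phi> (at (y - r *\<^sub>R v)) v)"
proof -
  have D: "((\<lambda>r. \<phi> (y - r *\<^sub>R v)) has_vector_derivative - frechet_derivative \<phi> (at (y - r *\<^sub>R v)) v) (at r within {0..1})" for r
  proof -
    have \<phi>': "(\<phi> has_derivative frechet_derivative \<phi> (at (y - r *\<^sub>R v))) (at (y - r *\<^sub>R v))"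
      using test_fun_differentiable[OF assms] frechet_derivative_works by blast
    have "((\<lambda>r. \<phi> (y - r *\<^sub>R v)) has_derivative (\<lambda>h. frechet_derivative \<phi> (at (y - r *\<^sub>R v)) (- (h *\<^sub>R v)))) (at r within {0..1})"
      by (rule has_derivative_compose[where g=\<phi> and f="\<lambda>r. y - r *\<^sub>R v", OF _ \<phi>']) (auto intro!: derivative_eq_intros)
    then show ?thesis
      unfolding has_vector_derivative_def
      by (simp add: linear_neg linear_cmul linear_frechet_derivative test_fun_differentiable[OF assms])
  qed
  have "continuous_on {0..1} (\<lambda>r. frechet_derivative \<phi> (at (y - r *\<^sub>R v)) v)"
    by (rule continuous_on_compose2[OF test_fun_continuous[OF test_fun_frechet_derivative[OF assms, of v]],
          of _ "\<lambda>r. y - r *\<^sub>R v"]) (intro continuous_intros, simp)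
  from integral_FTC_Icc[OF _ D continuous_on_minus[OF this]] show ?thesis by simp
qed

section \<open>Increments of a weakly differentiable function\<close>

lemma integrable_pair_shear_localized:
  fixes h \<psi> :: "'a::euclidean_space \<Rightarrow> real" and v :: 'a
  assumes meas[measurable]: "h \<in> borel_measurable borel" "\<psi> \<in> borel_measurable borel"
    and h: "\<And>\<rho>. set_integrable lborel (cball 0 \<rho>) h"
    and C: "C \<ge> 0" "\<And>x. \<bar>\<psi> x\<bar> \<le> C * indicator (cball 0 \<rho>) x"
  shows "integrable (lborel \<Otimes>\<^sub>M lborel) (\<lambda>(x, r). indicator {0..1} r * (h (x + r *\<^sub>R v) * \<psi> x))"
proof (rule integrable_pair_if_bounded_by_shear)
  let ?G = "\<lambda>y. C * \<bar>indicator (cball 0 (\<rho> + norm v)) y *\<^sub>R h y\<bar>"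
  show "integrable lborel ?G"
    using h[of "\<rho> + norm v"] unfolding set_integrable_def
    by (intro integrable_mult_right integrable_abs)
  show "\<bar>case (x, r) of (x, r) \<Rightarrow> indicator {0..1} r * (h (x + r *\<^sub>R v) * \<psi> x)\<bar> \<le> indicator {0..1} r * ?G (x + r *\<^sub>R v)" for x r
  proof (cases "r \<in> {0..1} \<and> norm x \<le> \<rho>")
    case True
    have "norm (x + r *\<^sub>R v) \<le> norm x + r * norm v"
      using norm_triangle_ineq[of x "r *\<^sub>R v"] True by simp
    also have "\<dots> \<le> \<rho> + norm v"
      using True by (intro add_mono mult_left_le_one_le) auto
    finally have "x + r *\<^sub>R v \<in> cball 0 (\<rho> + norm v)" by simp
    moreover have "\<bar>h (x + r *\<^sub>R v) * \<psi> x\<bar> \<le> \<bar>h (x + r *\<^sub>R v)\<bar> * C"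
      unfolding abs_mult using C(2)[of x] True by (intro mult_left_mono) auto
    ultimately show ?thesis using True by (simp add: mult.commute)
  next
    case False
    then have "indicator {0..1} r = (0::real) \<or> \<psi> x = 0"
      using C(2)[of x] by (auto simp: indicator_def)
    then show ?thesis using C(1) by auto
  qed
qed simp

text \<open>The fundamental theorem of calculus along the segment from \<open>x\<close> to \<open>x + v\<close>.  Tested against
  \<open>\<phi>\<close>, the left-hand side is the integral of \<open>u y * (\<phi> (y - v) - \<phi> y)\<close>.  The difference of \<open>\<phi>\<close> is an
  integral over \<open>r\<close> of directional derivatives of the test functions \<open>\<phi> (y - r v)\<close>; for each \<open>r\<close>
  the definition of the weak gradient moves the derivative to \<open>u\<close>, and a translation by \<open>r v\<close>
  turns the result into the right-hand side tested against \<open>\<phi>\<close>.\<close>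

lemma weak_gradient_difference:
  fixes u :: "'a::euclidean_space \<Rightarrow> real" and g :: "'a \<Rightarrow> 'a" and v :: 'a
  assumes meas[measurable]: "u \<in> borel_measurable borel" "g \<in> borel_measurable borel"
    and u: "\<And>\<rho>. set_integrable lborel (cball 0 \<rho>) u"
    and g: "\<And>\<rho>. set_integrable lborel (cball 0 \<rho>) g"
    and weak: "\<And>\<phi> i. test_fun \<phi> \<Longrightarrow> i \<in> Basis \<Longrightarrow>
      (LINT x|lborel. u x * frechet_derivative \<phi> (at x) i) = - (LINT x|lborel. (g x \<bullet> i) * \<phi> x)"
  shows "AE x in lborel. u (x + v) - u x = (LINT r|lborel. indicator {0..1} r * (g (x + r *\<^sub>R v) \<bullet> v))"
proof -
  define h where "h y = g y \<bullet> v" for y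
  define A where "A x = (LINT r|lborel. indicator {0..1} r * h (x + r *\<^sub>R v))" for x
  have [measurable]: "h \<in> borel_measurable borel" unfolding h_def by simp
  have [measurable]: "A \<in> borel_measurable borel" unfolding A_def by measurable
  have A_mult: "(LINT r|lborel. indicator {0..1} r * (h (x + r *\<^sub>R v) * c)) = A x * c" for x c
    unfolding A_def mult.assoc[symmetric] by (rule integral_mult_left_zero)
  have h: "set_integrable lborel (cball 0 \<rho>) h" for \<rho>
    using integrable_inner_left[where c=v, OF g[unfolded set_integrable_def]]
    unfolding set_integrable_def h_def by simp
  have "AE x in lborel. u (x + v) - u x - A x = 0"
  proof (rule AE_eq_0_if_integrals_test_fun_0)
    fix a b :: 'a
    obtain \<rho> where \<rho>: "cbox a b \<subseteq> cball 0 \<rho>"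
      using bounded_cbox[of a b] by (auto simp: bounded_iff subset_iff)
    have loc: "integrable lborel (\<lambda>x. indicator (cbox a b) x *\<^sub>R u x)"
      using set_integrable_subset[OF u[of \<rho>] _ \<rho>] by (simp add: set_integrable_def)
    have "integrable lborel (\<lambda>x. indicator (cball 0 (\<rho> + norm v)) (x + v) *\<^sub>R u (x + v))"
      using u[of "\<rho> + norm v"]
        integral_lborel_translate(2)[of "\<lambda>x. indicator (cball 0 (\<rho> + norm v)) x *\<^sub>R u x" v]
      unfolding set_integrable_def by simp
    then have "integrable lborel (\<lambda>x. indicator (cbox a b) x *\<^sub>R u (x + v))"
    proof (rule Bochner_Integration.integrable_bound)
      show "AE x in lborel. norm (indicator (cbox a b) x *\<^sub>R u (x + v)) \<le>
          norm (indicator (cball 0 (\<rho> + norm v)) (x + v) *\<^sub>R u (x + v))"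
      proof (rule AE_I2)
        fix x
        have "x \<in> cbox a b \<Longrightarrow> x + v \<in> cball 0 (\<rho> + norm v)"
          using \<rho> norm_triangle_ineq[of x v] by auto
        then show "norm (indicator (cbox a b) x *\<^sub>R u (x + v)) \<le>
            norm (indicator (cball 0 (\<rho> + norm v)) (x + v) *\<^sub>R u (x + v))"
          by (auto simp: indicator_def)
      qed
    qed simp
    moreover have "integrable lborel (\<lambda>x. indicator (cbox a b) x *\<^sub>R A x)"
    proof -
      have "\<bar>indicator (cbox a b) x :: real\<bar> \<le> 1 * indicator (cball 0 \<rho>) x" for x
        using \<rho> by (auto simp: indicator_def)
      from lborel_pair.integrable_fst[OF integrable_pair_shear_localized[OF _ _ h _ this, of v]]
      have "integrable lborel (\<lambda>x. LINT r|lborel. indicator {0..1} r * (h (x + r *\<^sub>R v) * indicator (cbox a b) x))"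
        by simp
      then show ?thesis
        unfolding A_mult by (simp add: mult.commute)
    qed
    ultimately show "set_integrable lborel (cbox a b) (\<lambda>x. u (x + v) - u x - A x)"
      using loc unfolding set_integrable_def by (simp add: algebra_simps)
  next
    fix \<phi> :: "'a \<Rightarrow> real" assume \<phi>: "test_fun \<phi>"
    define D where "D x = frechet_derivative \<phi> (at x) v" for x
    have D: "test_fun D" unfolding D_def by (rule test_fun_frechet_derivative[OF \<phi>])
    note [measurable] = test_fun_measurable[OF \<phi>] test_fun_measurable[OF D]
    have shift: "test_fun (\<lambda>x. \<phi> (x - w))" for w by (rule test_fun_translate[OF \<phi>])
    have [measurable]: "(\<lambda>x. \<phi> (x - w)) \<in> borel_measurable borel" for w
      by (rule test_fun_measurable[OF shift])
    have weak_shift: "(LINT y|lborel. u y * D (y - w)) = - (LINT y|lborel. h y * \<phi> (y - w))" for w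
      using weak_gradient_direction[OF meas u g weak shift, of w v]
      unfolding D_def h_def frechet_derivative_translate[OF test_fun_differentiable[OF \<phi>]] .
    obtain C \<rho> where C: "C \<ge> 0" "\<And>x. \<bar>\<phi> x\<bar> \<le> C * indicator (cball 0 \<rho>) x"
      using test_fun_bounded[OF \<phi>] by blast
    note Ig = integrable_pair_shear_localized[OF _ _ h C, of v, simplified]
    have Iu: "integrable (lborel \<Otimes>\<^sub>M lborel) (\<lambda>(y, r). indicator {0..1::real} r * (u y * - D (y - r *\<^sub>R v)))"
    proof -
      obtain C' \<rho>' where C': "C' \<ge> 0" "\<And>x. \<bar>D x\<bar> \<le> C' * indicator (cball 0 \<rho>') x"
        using test_fun_bounded[OF D] by blast
      let ?G = "\<lambda>y. C' * \<bar>indicator (cball 0 (\<rho>' + norm v)) y *\<^sub>R u y\<bar>"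
      show ?thesis
      \<comment> \<open>Here \<open>u y\<close> does not move with \<open>r\<close>, so the majorant is taken without a shear.\<close>
      proof (rule integrable_pair_if_bounded_by_shear[where w=0])
        show "integrable lborel ?G"
          using u[of "\<rho>' + norm v"] unfolding set_integrable_def
          by (intro integrable_mult_right integrable_abs)
        show "\<bar>case (y, r) of (y, r) \<Rightarrow> indicator {0..1} r * (u y * - D (y - r *\<^sub>R v))\<bar> \<le> indicator {0..1} r * ?G (y + r *\<^sub>R 0)" for y r
        proof (cases "r \<in> {0..1} \<and> norm (y - r *\<^sub>R v) \<le> \<rho>'")
          case True
          have "norm y \<le> norm (y - r *\<^sub>R v) + r * norm v"
            using norm_triangle_ineq[of "y - r *\<^sub>R v" "r *\<^sub>R v"] True by simp
          also have "\<dots> \<le> \<rho>' + norm v"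
            using True by (intro add_mono mult_left_le_one_le) auto
          finally have "y \<in> cball 0 (\<rho>' + norm v)" by simp
          moreover have "\<bar>u y * D (y - r *\<^sub>R v)\<bar> \<le> \<bar>u y\<bar> * C'"
            unfolding abs_mult using C'(2)[of "y - r *\<^sub>R v"] True by (intro mult_left_mono) auto
          ultimately show ?thesis using True by (simp add: mult.commute)
        next
          case False
          then have "indicator {0..1} r = (0::real) \<or> D (y - r *\<^sub>R v) = 0"
            using C'(2)[of "y - r *\<^sub>R v"] by (auto simp: indicator_def)
          then show ?thesis using C'(1) by auto
        qed
      qed simp
    qed
    have tr: "(LINT x|lborel. u (x + v) * \<phi> x) = (LINT y|lborel. u y * \<phi> (y - v))"
      using integral_lborel_translate(1)[of "\<lambda>y. u y * \<phi> (y - v)" v] by simp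
    have i1: "integrable lborel (\<lambda>x. u (x + v) * \<phi> x)"
      using integral_lborel_translate(2)[of "\<lambda>y. u y * \<phi> (y - v)" v]
        integrable_mult_test_fun[OF _ u shift] by simp
    have i2: "integrable lborel (\<lambda>x. u x * \<phi> x)"
      by (rule integrable_mult_test_fun[OF _ u \<phi>]) simp
    have i2': "integrable lborel (\<lambda>x. u x * \<phi> (x - v))"
      by (rule integrable_mult_test_fun[OF _ u shift]) simp
    have A\<phi>: "A x * \<phi> x = (LINT r|lborel. indicator {0..1} r * (h (x + r *\<^sub>R v) * \<phi> x))" for x
      by (rule A_mult[symmetric])
    have i3: "integrable lborel (\<lambda>x. A x * \<phi> x)"
      unfolding A\<phi> by (rule lborel_pair.integrable_fst[OF Ig])
    have "(LINT x|lborel. u (x + v) * \<phi> x) - (LINT x|lborel. u x * \<phi> x) =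
        (LINT y|lborel. u y * (\<phi> (y - v) - \<phi> y))"
      unfolding tr using i2 i2' by (simp add: right_diff_distrib)
    also have "\<dots> = (LINT y|lborel. LINT r|lborel. indicator {0..1} r * (u y * - D (y - r *\<^sub>R v)))"
    proof (rule Bochner_Integration.integral_cong[OF refl])
      fix y
      have "u y * (\<phi> (y - v) - \<phi> y) = (LINT r|lborel. u y * (indicator {0..1} r * - D (y - r *\<^sub>R v)))"
        unfolding test_fun_diff_eq_integral[OF \<phi>] D_def by (rule integral_mult_right_zero[symmetric])
      also have "\<dots> = (LINT r|lborel. indicator {0..1} r * (u y * - D (y - r *\<^sub>R v)))"
        by (simp only: mult.left_commute)
      finally show "u y * (\<phi> (y - v) - \<phi> y) = (LINT r|lborel. indicator {0..1} r * (u y * - D (y - r *\<^sub>R v)))" .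
    qed
    also have "\<dots> = (LINT r|lborel. LINT y|lborel. indicator {0..1} r * (u y * - D (y - r *\<^sub>R v)))"
      by (rule lborel_pair.Fubini_integral[OF Iu, symmetric])
    also have "\<dots> = (LINT r|lborel. LINT y|lborel. indicator {0..1} r * (h y * \<phi> (y - r *\<^sub>R v)))"
      by (simp add: weak_shift)
    also have "\<dots> = (LINT r|lborel. LINT x|lborel. indicator {0..1} r * (h (x + r *\<^sub>R v) * \<phi> x))"
    proof (rule Bochner_Integration.integral_cong[OF refl])
      show "(LINT y|lborel. indicator {0..1} r * (h y * \<phi> (y - r *\<^sub>R v))) =
        (LINT x|lborel. indicator {0..1} r * (h (x + r *\<^sub>R v) * \<phi> x))" for r :: real
        using integral_lborel_translate(1)[of "\<lambda>y. h y * \<phi> (y - r *\<^sub>R v)" "r *\<^sub>R v"]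
        by simp
    qed
    also have "\<dots> = (LINT x|lborel. A x * \<phi> x)"
      unfolding A\<phi> by (rule lborel_pair.Fubini_integral[OF Ig])
    finally show "(LINT x|lborel. (u (x + v) - u x - A x) * \<phi> x) = 0"
      using i1 i2 i3 by (simp add: left_diff_distrib)
  qed simp
  then show ?thesis unfolding A_def h_def by (auto elim!: eventually_mono)
qed

section \<open>Integration along rays\<close>

lemma nn_integral_lborel_scale:
  fixes f :: "'a::euclidean_space \<Rightarrow> ennreal"
  assumes [measurable]: "f \<in> borel_measurable borel" and "r > 0"
  shows "(\<integral>\<^sup>+v. f (r *\<^sub>R v) \<partial>lborel) = ennreal (1 / r ^ DIM('a)) * (\<integral>\<^sup>+w. f w \<partial>lborel)"
proof -
  have "(\<integral>\<^sup>+w. f w \<partial>lborel) = (\<integral>\<^sup>+w. f w \<partial>density (distr lborel borel (\<lambda>x. 0 + r *\<^sub>R x)) (\<lambda>_. \<bar>r\<bar> ^ DIM('a)))"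
    using lborel_affine[of r "0::'a"] \<open>r > 0\<close> by simp
  also have "\<dots> = ennreal (r ^ DIM('a)) * (\<integral>\<^sup>+v. f (r *\<^sub>R v) \<partial>lborel)"
    using \<open>r > 0\<close> by (simp add: nn_integral_density nn_integral_distr nn_integral_cmult)
  finally have "ennreal (1 / r ^ DIM('a)) * (\<integral>\<^sup>+w. f w \<partial>lborel) =
      (ennreal (1 / r ^ DIM('a)) * ennreal (r ^ DIM('a))) * (\<integral>\<^sup>+v. f (r *\<^sub>R v) \<partial>lborel)"
    by (simp add: mult.assoc)
  also have "ennreal (1 / r ^ DIM('a)) * ennreal (r ^ DIM('a)) = 1"
    using \<open>r > 0\<close> by (simp flip: ennreal_mult)
  finally show ?thesis by simp
qed

lemma nn_integral_inverse_power_tail: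
  assumes "a > 0" "n > 0"
  shows "(\<integral>\<^sup>+r. ennreal (if a < r then 1 / r ^ Suc n else 0) \<partial>lborel) = ennreal (1 / (real n * a ^ n))"
proof -
  have "(\<integral>\<^sup>+r. ennreal (if a < r then 1 / r ^ Suc n else 0) \<partial>lborel) =
      (\<integral>\<^sup>+r. ennreal (1 / r ^ Suc n) * indicator {a..} r \<partial>lborel)"
    by (rule nn_integral_cong_AE, rule AE_mp[OF AE_lborel_singleton[of a]])
       (auto simp: indicator_def intro!: AE_I2)
  also have "\<dots> = ennreal (0 - - (1 / (real n * a ^ n)))"
  proof (rule nn_integral_FTC_atLeast)
    show "((\<lambda>r. - (1 / (real n * r ^ n))) \<longlongrightarrow> 0) at_top"
    proof -
      have "((\<lambda>r::real. - (1 / real n * inverse (r ^ n))) \<longlongrightarrow> - (1 / real n * 0)) at_top"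
        using assms by (intro tendsto_intros tendsto_inverse_0_at_top filterlim_pow_at_top filterlim_ident) auto
      then show ?thesis by (simp add: divide_inverse)
    qed
    show "((\<lambda>r. - (1 / (real n * r ^ n))) has_real_derivative 1 / x ^ Suc n) (at x)" if "a \<le> x" for x
    proof -
      have x: "x > 0" using that assms by simp
      have "((\<lambda>r. inverse (r ^ n)) has_real_derivative - (real n * x ^ (n - 1) * inverse ((x ^ n) ^ 2))) (at x)"
        using x by (auto intro!: derivative_eq_intros simp: power2_eq_square)
      from DERIV_cmult[OF this, of "- 1 / real n"]
      have "((\<lambda>r. - 1 / real n * inverse (r ^ n)) has_real_derivative x ^ (n - 1) * inverse ((x ^ n) ^ 2)) (at x)"
        using assms by simp
      also have "x ^ (n - 1) * inverse ((x ^ n) ^ 2) = 1 / x ^ Suc n"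
        using x assms by (cases n) (simp_all add: field_simps power2_eq_square)
      also have "(\<lambda>r. - 1 / real n * inverse (r ^ n)) = (\<lambda>r. - (1 / (real n * r ^ n)))"
        by (simp add: fun_eq_iff divide_inverse)
      finally show ?thesis .
    qed
  qed (use assms in auto)
  finally show ?thesis by simp
qed

text \<open>The measure \<open>dv dr / r\<close> on pairs of a point \<open>v\<close> of the unit ball and a parameter \<open>r > 0\<close>.
  Averages over rays are taken with respect to points of the ball, whose volume is Lebesgue
  measure, in place of points of the sphere.\<close>

definition ray_measure :: "('a::euclidean_space \<times> real) measure" where
  "ray_measure = density (lborel \<Otimes>\<^sub>M lborel)
     (\<lambda>(v, r). ennreal (if norm v < 1 \<and> 0 < r then 1 / r else 0))"

text \<open>Substituting \<open>w = r v\<close> at fixed \<open>r\<close> contributes \<open>r ^ (- n)\<close> and turns \<open>norm v < 1\<close> into \<open>norm w < r\<close>.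
  Each \<open>w\<close> therefore receives the mass \<open>\<integral> r ^ (- n - 1) dr\<close> over \<open>r > norm w\<close>, which is
  \<open>1 / (n * norm w ^ n)\<close>: this is where the kernel and the constant of the representation formula
  come from.\<close>

lemma distr_ray_measure:
  "distr ray_measure borel (\<lambda>(v, r). r *\<^sub>R v) =
     density lborel (\<lambda>w::'a::euclidean_space. ennreal (1 / (DIM('a) * norm w ^ DIM('a))))"
proof (rule measure_eqI)
  fix A assume "A \<in> sets (distr ray_measure borel (\<lambda>(v::'a, r). r *\<^sub>R v))"
  then have A[measurable]: "A \<in> sets borel" by simp
  let ?n = "DIM('a)"
  have "emeasure (distr ray_measure borel (\<lambda>(v::'a, r). r *\<^sub>R v)) A =
      (\<integral>\<^sup>+p. indicator A (snd p *\<^sub>R fst p) \<partial>ray_measure)"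
    by (subst nn_integral_indicator[symmetric], simp, subst nn_integral_distr)
       (auto simp: ray_measure_def case_prod_beta)
  also have "\<dots> = (\<integral>\<^sup>+p. ennreal (if norm (fst p) < 1 \<and> 0 < snd p then 1 / snd p else 0) * indicator A (snd p *\<^sub>R fst p) \<partial>(lborel \<Otimes>\<^sub>M lborel))"
    unfolding ray_measure_def case_prod_beta by (rule nn_integral_density) auto
  also have "\<dots> = (\<integral>\<^sup>+r. \<integral>\<^sup>+v. ennreal (if norm v < 1 \<and> 0 < r then 1 / r else 0) * indicator A (r *\<^sub>R v) \<partial>lborel \<partial>lborel)"
    by (subst lborel_pair.nn_integral_snd[symmetric]) (simp_all only: fst_conv snd_conv, measurable)
  also have "\<dots> = (\<integral>\<^sup>+r. \<integral>\<^sup>+w. indicator A w * ennreal (if norm w < r then 1 / r ^ Suc ?n else 0) \<partial>lborel \<partial>lborel)"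
  proof (rule nn_integral_cong)
    fix r :: real
    show "(\<integral>\<^sup>+v. ennreal (if norm v < 1 \<and> 0 < r then 1 / r else 0) * indicator A (r *\<^sub>R v) \<partial>lborel) =
       (\<integral>\<^sup>+w. indicator A w * ennreal (if norm w < r then 1 / r ^ Suc ?n else 0) \<partial>lborel)"
    proof (cases "r > 0")
      case r: True
      have "(\<integral>\<^sup>+v. ennreal (if norm v < 1 \<and> 0 < r then 1 / r else 0) * indicator A (r *\<^sub>R v) \<partial>lborel) =
          (\<integral>\<^sup>+v. (\<lambda>w. ennreal (if norm w < r then 1 / r else 0) * indicator A w) (r *\<^sub>R v) \<partial>lborel)"
        using r by (intro nn_integral_cong) (auto simp: indicator_def)
      also have "\<dots> = ennreal (1 / r ^ ?n) * (\<integral>\<^sup>+w. ennreal (if norm w < r then 1 / r else 0) * indicator A w \<partial>lborel)"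
        using r by (intro nn_integral_lborel_scale) auto
      also have "\<dots> = (\<integral>\<^sup>+w. ennreal (1 / r ^ ?n) * (ennreal (if norm w < r then 1 / r else 0) * indicator A w) \<partial>lborel)"
        by (rule nn_integral_cmult[symmetric]) auto
      also have "\<dots> = (\<integral>\<^sup>+w. indicator A w * ennreal (if norm w < r then 1 / r ^ Suc ?n else 0) \<partial>lborel)"
        using r by (intro nn_integral_cong) (auto simp: indicator_def simp flip: ennreal_mult)
      finally show ?thesis .
    next
      case False
      then have "\<not> norm w < r" for w :: 'a
        using norm_ge_zero[of w] by linarith
      with False show ?thesis by simp
    qed
  qed
  also have "\<dots> = (\<integral>\<^sup>+w. \<integral>\<^sup>+r. indicator A w * ennreal (if norm w < r then 1 / r ^ Suc ?n else 0) \<partial>lborel \<partial>lborel)"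
    by (rule lborel_pair.Fubini') (auto simp: case_prod_beta)
  also have "\<dots> = (\<integral>\<^sup>+w. ennreal (1 / (?n * norm w ^ ?n)) * indicator A w \<partial>lborel)"
  proof (rule nn_integral_cong_AE, rule AE_mp[OF AE_lborel_singleton[of 0]], intro AE_I2 impI)
    fix w :: 'a assume "w \<noteq> 0"
    then have "(\<integral>\<^sup>+r. ennreal (if norm w < r then 1 / r ^ Suc ?n else 0) \<partial>lborel) = ennreal (1 / (?n * norm w ^ ?n))"
      by (intro nn_integral_inverse_power_tail) auto
    then show "(\<integral>\<^sup>+r. indicator A w * ennreal (if norm w < r then 1 / r ^ Suc ?n else 0) \<partial>lborel) =
       ennreal (1 / (?n * norm w ^ ?n)) * indicator A w"
      by (subst nn_integral_cmult) (auto simp: mult.commute)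
  qed
  also have "\<dots> = emeasure (density lborel (\<lambda>w::'a. ennreal (1 / (?n * norm w ^ ?n)))) A"
    by (rule emeasure_density[symmetric]) auto
  finally show "emeasure (distr ray_measure borel (\<lambda>(v, r). r *\<^sub>R v)) A =
    emeasure (density lborel (\<lambda>w::'a. ennreal (1 / (?n * norm w ^ ?n)))) A" .
qed simp

text \<open>Fubini splits the product integral into integrals along single rays, where the increments of a
  function of one variable are available; the other integral is over space.\<close>

lemma
  fixes H :: "'a::euclidean_space \<Rightarrow> real"
  assumes [measurable]: "H \<in> borel_measurable borel"
  defines "J \<equiv> \<lambda>(v, r). (if norm v < 1 \<and> 0 < r then 1 / r else 0) * H (r *\<^sub>R v)"
  shows integrable_along_rays_iff: "integrable (lborel \<Otimes>\<^sub>M lborel) J \<longleftrightarrow>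
      integrable lborel (\<lambda>w. H w / (DIM('a) * norm w ^ DIM('a)))"
    and integral_along_rays: "integral\<^sup>L (lborel \<Otimes>\<^sub>M lborel) J =
      (LINT w|lborel. H w / (DIM('a) * norm w ^ DIM('a)))"
proof -
  let ?f = "\<lambda>w::'a. 1 / (DIM('a) * norm w ^ DIM('a))"
  let ?d = "\<lambda>(v::'a, r::real). if norm v < 1 \<and> 0 < r then 1 / r else 0"
  have J: "J = (\<lambda>p. ?d p *\<^sub>R H (snd p *\<^sub>R fst p))"
    unfolding J_def by (auto simp: fun_eq_iff)
  have d[measurable]: "?d \<in> borel_measurable (lborel \<Otimes>\<^sub>M lborel)" by measurable
  have dens: "ray_measure = density (lborel \<Otimes>\<^sub>M lborel) (\<lambda>p. ennreal (?d p))"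
    unfolding ray_measure_def by (rule arg_cong2[where f=density]) (auto simp: fun_eq_iff)
  have D: "distr ray_measure borel (\<lambda>p. snd p *\<^sub>R fst p) = density lborel (\<lambda>w::'a. ennreal (?f w))"
    using distr_ray_measure[where 'a='a] by (simp add: case_prod_beta')
  have [measurable]: "(\<lambda>p::'a \<times> real. snd p *\<^sub>R fst p) \<in> measurable ray_measure borel"
    unfolding ray_measure_def by simp
  have "integrable (lborel \<Otimes>\<^sub>M lborel) J \<longleftrightarrow> integrable ray_measure (\<lambda>p. H (snd p *\<^sub>R fst p))"
    unfolding dens J by (rule integrable_density[symmetric]) auto
  also have "\<dots> \<longleftrightarrow> integrable (density lborel (\<lambda>w::'a. ennreal (?f w))) H"
    unfolding D[symmetric] by (rule integrable_distr_eq[symmetric]) auto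
  also have "\<dots> \<longleftrightarrow> integrable lborel (\<lambda>w. ?f w *\<^sub>R H w)"
    by (rule integrable_density) auto
  finally show "integrable (lborel \<Otimes>\<^sub>M lborel) J \<longleftrightarrow>
      integrable lborel (\<lambda>w. H w / (DIM('a) * norm w ^ DIM('a)))" by simp
  have "integral\<^sup>L (lborel \<Otimes>\<^sub>M lborel) J = (LINT p|ray_measure. H (snd p *\<^sub>R fst p))"
    unfolding dens J by (rule integral_density[symmetric]) auto
  also have "\<dots> = integral\<^sup>L (density lborel (\<lambda>w::'a. ennreal (?f w))) H"
    unfolding D[symmetric] by (rule integral_distr[symmetric]) auto
  also have "\<dots> = (LINT w|lborel. ?f w *\<^sub>R H w)"
    by (rule integral_density) auto
  finally show "integral\<^sup>L (lborel \<Otimes>\<^sub>M lborel) J =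
      (LINT w|lborel. H w / (DIM('a) * norm w ^ DIM('a)))" by simp
qed

text \<open>The kernel is \<open>norm w / norm w ^ n\<close>, so it can be integrated along rays: a point \<open>v\<close> of the
  unit ball contributes \<open>norm v\<close> times the length of \<open>{r > 0. r * norm v < R}\<close>, and this
  product is at most \<open>\<bar>R\<bar>\<close>.\<close>

lemma nn_integral_riesz_kernel_ball_finite:
  "(\<integral>\<^sup>+w. ennreal (if norm w < R then 1 / norm w ^ (DIM('a) - 1) else 0) \<partial>(lborel::'a::euclidean_space measure)) < \<infinity>"
proof -
  let ?n = "DIM('a)"
  define H where "H w = (if norm w < R then norm w else 0)" for w :: 'a
  let ?J = "\<lambda>(v::'a, r). (if norm v < 1 \<and> 0 < r then 1 / r else 0) * H (r *\<^sub>R v)"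
  have [measurable]: "H \<in> borel_measurable borel" unfolding H_def by measurable
  have "integrable (lborel \<Otimes>\<^sub>M lborel) ?J"
  proof (rule integrableI_bounded)
    have "(\<integral>\<^sup>+p. ennreal (norm (?J p)) \<partial>(lborel \<Otimes>\<^sub>M lborel)) = (\<integral>\<^sup>+v. \<integral>\<^sup>+r. ennreal (norm (?J (v, r))) \<partial>lborel \<partial>lborel)"
      by (rule lborel.nn_integral_fst[symmetric]) measurable
    also have "\<dots> \<le> (\<integral>\<^sup>+v. ennreal \<bar>R\<bar> * indicator (ball 0 1) (v::'a) \<partial>lborel)"
    proof (rule nn_integral_mono)
      fix v :: 'a
      show "(\<integral>\<^sup>+r. ennreal (norm (?J (v, r))) \<partial>lborel) \<le> ennreal \<bar>R\<bar> * indicator (ball 0 1) v"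
      proof (cases "norm v < 1 \<and> v \<noteq> 0")
        case True
        have "(\<integral>\<^sup>+r. ennreal (norm (?J (v, r))) \<partial>lborel) \<le> (\<integral>\<^sup>+r. ennreal (norm v) * indicator {0..\<bar>R\<bar> / norm v} r \<partial>lborel)"
        proof (rule nn_integral_mono)
          fix r :: real
          show "ennreal (norm (?J (v, r))) \<le> ennreal (norm v) * indicator {0..\<bar>R\<bar> / norm v} r"
          proof (cases "0 < r \<and> r * norm v < R")
            case 1: True
            then have "r \<in> {0..\<bar>R\<bar> / norm v}"
              using True by (auto simp: pos_le_divide_eq)
            then show ?thesis using 1 by (simp add: H_def)
          next
            case False
            then have "?J (v, r) = 0" by (auto simp: H_def)
            then show ?thesis by (simp only: norm_zero ennreal_0 zero_le)
          qed
        qed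
        also have "\<dots> = ennreal (norm v) * ennreal (\<bar>R\<bar> / norm v)"
          by (subst nn_integral_cmult_indicator) auto
        also have "\<dots> = ennreal \<bar>R\<bar>" using True by (simp flip: ennreal_mult)
        finally show ?thesis using True by simp
      next
        case False
        then have "?J (v, r) = 0" for r by (auto simp: H_def)
        then show ?thesis by (simp only: norm_zero ennreal_0 zero_le nn_integral_const mult_zero_left)
      qed
    qed
    also have "\<dots> = ennreal \<bar>R\<bar> * emeasure lborel (ball (0::'a) 1)"
      by (rule nn_integral_cmult_indicator) simp
    also have "\<dots> < \<infinity>"
      using emeasure_lborel_ball_finite[of "0::'a" 1] by (simp add: ennreal_mult_less_top)
    finally show "(\<integral>\<^sup>+p. ennreal (norm (?J p)) \<partial>(lborel \<Otimes>\<^sub>M lborel)) < \<infinity>" .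
  qed measurable
  then have "integrable lborel (\<lambda>w. H w / (?n * norm w ^ ?n))"
    by (simp only: integrable_along_rays_iff[OF \<open>H \<in> borel_measurable borel\<close>])
  then have "integrable lborel (\<lambda>w. real ?n * (H w / (?n * norm w ^ ?n)))"
    by (rule integrable_mult_right)
  then have "(\<integral>\<^sup>+w. ennreal (norm (real ?n * (H w / (?n * norm w ^ ?n)))) \<partial>lborel) < \<infinity>"
    by (simp add: integrable_iff_bounded)
  also have "(\<integral>\<^sup>+w. ennreal (norm (real ?n * (H w / (?n * norm w ^ ?n)))) \<partial>lborel) =
    (\<integral>\<^sup>+w. ennreal (if norm w < R then 1 / norm w ^ (?n - 1) else 0) \<partial>(lborel::'a measure))"
  proof (rule nn_integral_cong_AE, rule AE_mp[OF AE_lborel_singleton[of 0]], intro AE_I2 impI)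
    fix w :: 'a assume "w \<noteq> 0"
    have "norm w ^ ?n = norm w * norm w ^ (?n - 1)"
      using power_minus_mult[OF DIM_positive[where 'a='a], of "norm w"] by (simp add: mult.commute)
    then show "ennreal (norm (real ?n * (H w / (?n * norm w ^ ?n)))) =
       ennreal (if norm w < R then 1 / norm w ^ (?n - 1) else 0)"
      using \<open>w \<noteq> 0\<close> by (simp add: H_def)
  qed
  finally show ?thesis .
qed

section \<open>Riesz potential of the gradient\<close>

text \<open>For \<open>norm x < m\<close> split at \<open>norm y = 2 m\<close>.  Beyond it \<open>norm (x - y) \<ge> norm y / 2\<close>, and the
  hypothesis \<open>far\<close> applies.  The rest is a convolution of an integrable function with a kernel that
  is integrable near the origin; it has finite integral in \<open>x\<close>, hence is finite almost everywhere.\<close>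

lemma AE_integrable_riesz_potential:
  fixes g :: "'a::euclidean_space \<Rightarrow> 'a"
  assumes [measurable]: "g \<in> borel_measurable borel"
    and g: "\<And>\<rho>. set_integrable lborel (cball 0 \<rho>) g"
    and far: "set_integrable lborel (- ball 0 1) (\<lambda>x. norm (g x) / norm x ^ (DIM('a) - 1))"
  shows "AE x in lborel. integrable lborel (\<lambda>w. norm (g (x + w)) / norm w ^ (DIM('a) - 1))"
proof -
  let ?n1 = "DIM('a) - 1"
  have "AE x in lborel. norm x < real m \<longrightarrow> integrable lborel (\<lambda>w. norm (g (x + w)) / norm w ^ ?n1)"
    if m: "m \<ge> 1" for m :: nat
  proof -
    \<comment> \<open>If \<open>norm x < m\<close> and \<open>norm y \<le> 2 m\<close>, then \<open>x - y\<close> has norm below \<open>3 m\<close>.\<close>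
    let ?k = "\<lambda>w::'a. ennreal (if norm w < 3 * real m then 1 / norm w ^ ?n1 else 0)"
    let ?g = "\<lambda>y. ennreal (if norm y \<le> 2 * real m then norm (g y) else 0)"
    have "(\<integral>\<^sup>+y. ?g y \<partial>lborel) = (\<integral>\<^sup>+y. ennreal (norm (indicator (cball 0 (2 * real m)) y *\<^sub>R g y)) \<partial>lborel)"
      by (intro nn_integral_cong) (simp add: indicator_def)
    also have "\<dots> < \<infinity>"
      using g[of "2 * real m"] by (simp add: set_integrable_def integrable_iff_bounded)
    finally have g_fin: "(\<integral>\<^sup>+y. ?g y \<partial>lborel) < \<infinity>" .
    let ?\<Phi> = "\<lambda>x. \<integral>\<^sup>+y. ?g y * ?k (x - y) \<partial>lborel"
    have "(\<integral>\<^sup>+x. ?\<Phi> x \<partial>lborel) = (\<integral>\<^sup>+y. \<integral>\<^sup>+x. ?g y * ?k (x - y) \<partial>lborel \<partial>lborel)"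
      by (rule lborel_pair.Fubini'[symmetric]) measurable
    also have "\<dots> = (\<integral>\<^sup>+y. ?g y * (\<integral>\<^sup>+x. ?k x \<partial>lborel) \<partial>lborel)"
    proof (rule nn_integral_cong)
      fix y :: 'a
      have k: "?k \<in> borel_measurable borel" by measurable
      have "(\<integral>\<^sup>+x. ?g y * ?k (x - y) \<partial>lborel) = ?g y * (\<integral>\<^sup>+x. ?k (x - y) \<partial>lborel)"
        by (rule nn_integral_cmult) measurable
      also have "(\<integral>\<^sup>+x. ?k (x - y) \<partial>lborel) = (\<integral>\<^sup>+x. ?k x \<partial>lborel)"
        using nn_integral_lborel_translate[OF k, of "- y"] unfolding add_uminus_conv_diff .
      finally show "(\<integral>\<^sup>+x. ?g y * ?k (x - y) \<partial>lborel) = ?g y * (\<integral>\<^sup>+x. ?k x \<partial>lborel)" .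
    qed
    also have "\<dots> = (\<integral>\<^sup>+y. ?g y \<partial>lborel) * (\<integral>\<^sup>+x. ?k x \<partial>lborel)"
      by (rule nn_integral_multc) measurable
    also have "\<dots> < \<infinity>"
      using nn_integral_riesz_kernel_ball_finite[of "3 * real m", where 'a='a] g_fin
      by (simp add: ennreal_mult_less_top)
    finally have "(\<integral>\<^sup>+x. ?\<Phi> x \<partial>lborel) \<noteq> \<infinity>" by simp
    then have "AE x in lborel. ?\<Phi> x \<noteq> \<infinity>"
      by (intro nn_integral_PInf_AE) measurable
    then show ?thesis
    proof (rule AE_mp, intro AE_I2 impI)
      fix x :: 'a assume fin: "?\<Phi> x \<noteq> \<infinity>" and x: "norm x < real m"
      let ?f = "\<lambda>y. indicator (- ball 0 1) y *\<^sub>R (norm (g y) / norm y ^ ?n1)"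
      have le: "ennreal (norm (g y) / norm (y - x) ^ ?n1) \<le> ?g y * ?k (x - y) + ennreal (2 ^ ?n1) * ennreal (norm (?f y))" for y
      proof (cases "norm y \<le> 2 * real m")
        case True
        have "norm (x - y) < 3 * real m"
          using norm_triangle_ineq4[of x y] x True by linarith
        then have "ennreal (norm (g y) / norm (y - x) ^ ?n1) = ?g y * ?k (x - y)"
          using True by (simp add: norm_minus_commute flip: ennreal_mult)
        then show ?thesis by simp
      next
        case False
        have y: "norm y \<ge> 1" using False m by linarith
        have "norm y / 2 \<le> norm (y - x)"
          using norm_triangle_ineq2[of y x] x False by linarith
        then have "(norm y / 2) ^ ?n1 \<le> norm (y - x) ^ ?n1" by (intro power_mono) auto
        then have "norm (g y) / norm (y - x) ^ ?n1 \<le> norm (g y) / (norm y / 2) ^ ?n1"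
        proof (rule divide_left_mono)
          show "0 < norm (y - x) ^ ?n1 * (norm y / 2) ^ ?n1"
            using y \<open>norm y / 2 \<le> norm (y - x)\<close> by (intro mult_pos_pos zero_less_power) linarith+
        qed simp_all
        also have "\<dots> = 2 ^ ?n1 * norm (?f y)"
          using y by (simp add: power_divide)
        finally have "ennreal (norm (g y) / norm (y - x) ^ ?n1) \<le> ennreal (2 ^ ?n1) * ennreal (norm (?f y))"
          by (simp add: ennreal_leI flip: ennreal_mult)
        then show ?thesis by (rule order_trans) simp
      qed
      have "(\<integral>\<^sup>+w. ennreal (norm (g (x + w)) / norm w ^ ?n1) \<partial>lborel) =
          (\<integral>\<^sup>+w. ennreal (norm (g (w + x)) / norm (w + x - x) ^ ?n1) \<partial>lborel)"
        by (simp add: add.commute)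
      also have "\<dots> = (\<integral>\<^sup>+y. ennreal (norm (g y) / norm (y - x) ^ ?n1) \<partial>lborel)"
        by (rule nn_integral_lborel_translate) measurable
      also have "\<dots> \<le> (\<integral>\<^sup>+y. ?g y * ?k (x - y) + ennreal (2 ^ ?n1) * ennreal (norm (?f y)) \<partial>lborel)"
        by (rule nn_integral_mono) (rule le)
      also have "\<dots> = ?\<Phi> x + ennreal (2 ^ ?n1) * (\<integral>\<^sup>+y. ennreal (norm (?f y)) \<partial>lborel)"
        by (subst nn_integral_add) (auto simp: nn_integral_cmult)
      also have "\<dots> < \<infinity>"
        using fin far unfolding set_integrable_def integrable_iff_bounded
        by (simp add: ennreal_mult_less_top less_top)
      finally show "integrable lborel (\<lambda>w. norm (g (x + w)) / norm w ^ ?n1)"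
        by (intro integrableI_bounded) auto
    qed
  qed
  then have "AE x in lborel. \<forall>m\<in>{1..}. norm x < real m \<longrightarrow> integrable lborel (\<lambda>w. norm (g (x + w)) / norm w ^ ?n1)"
    by (subst AE_ball_countable) auto
  then show ?thesis
  proof (rule AE_mp, intro AE_I2 impI)
    fix x :: 'a assume *: "\<forall>m\<in>{1..}. norm x < real m \<longrightarrow> integrable lborel (\<lambda>w. norm (g (x + w)) / norm w ^ ?n1)"
    obtain m where "norm x < real m" using reals_Archimedean2 by blast
    then show "integrable lborel (\<lambda>w. norm (g (x + w)) / norm w ^ ?n1)"
      using *[rule_format, of "Suc m"] by simp
  qed
qed

section \<open>Decay along dilations\<close>

text \<open>The map \<open>v \<mapsto> x + c v\<close> multiplies volumes by \<open>c ^ n\<close>.\<close>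

lemma emeasure_dilated_superlevel_le:
  fixes u :: "'a::euclidean_space \<Rightarrow> real"
  assumes [measurable]: "u \<in> borel_measurable borel" and "c > 0"
  shows "emeasure lborel {v. norm v < 1 \<and> t < \<bar>u (x + c *\<^sub>R v)\<bar>} \<le>
    ennreal (1 / c ^ DIM('a)) * emeasure lborel {y. t < \<bar>u y\<bar>}"
proof -
  let ?E = "{y. t < \<bar>u y\<bar>}"
  have "emeasure lborel {v. norm v < 1 \<and> t < \<bar>u (x + c *\<^sub>R v)\<bar>} =
      (\<integral>\<^sup>+v. indicator {v. norm v < 1 \<and> t < \<bar>u (x + c *\<^sub>R v)\<bar>} v \<partial>lborel)"
    by (rule nn_integral_indicator[symmetric]) measurable
  also have "\<dots> \<le> (\<integral>\<^sup>+v. (\<lambda>w. indicator ?E (w + x)) (c *\<^sub>R v) \<partial>lborel)"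
    by (intro nn_integral_mono) (auto simp: indicator_def add.commute)
  also have "\<dots> = ennreal (1 / c ^ DIM('a)) * (\<integral>\<^sup>+w. indicator ?E (w + x) \<partial>lborel)"
    by (rule nn_integral_lborel_scale) (use assms in measurable)
  also have "(\<integral>\<^sup>+w. indicator ?E (w + x) \<partial>lborel) = (\<integral>\<^sup>+w. indicator ?E w \<partial>lborel)"
    by (rule nn_integral_lborel_translate) measurable
  also have "\<dots> = emeasure lborel ?E"
    by (rule nn_integral_indicator) measurable
  finally show ?thesis .
qed

text \<open>Borel-Cantelli: along the dilations by \<open>2 ^ i\<close> the measures of the exceptional sets are
  dominated by a geometric series.  The powers of 2 serve only to make this sum finite.\<close>

lemma AE_dyadic_dilation_eventually_le:
  fixes u :: "'a::euclidean_space \<Rightarrow> real"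
  assumes [measurable]: "u \<in> borel_measurable borel"
    and fin: "emeasure lborel {y. t < \<bar>u y\<bar>} < \<infinity>"
  shows "AE v in lborel. norm v < 1 \<longrightarrow> (\<forall>\<^sub>F i in sequentially. \<bar>u (x + 2 ^ i *\<^sub>R v)\<bar> \<le> t)"
proof -
  let ?A = "\<lambda>i::nat. {v. norm v < 1 \<and> t < \<bar>u (x + 2 ^ i *\<^sub>R v)\<bar>}"
  let ?M = "measure lborel {y. t < \<bar>u y\<bar>}"
  have M: "emeasure lborel {y. t < \<bar>u y\<bar>} = ennreal ?M"
    using fin by (intro emeasure_eq_ennreal_measure) simp
  have le: "emeasure lborel (?A i) \<le> ennreal ((1 / 2) ^ i * ?M)" for i
  proof -
    have "emeasure lborel (?A i) \<le> ennreal (1 / (2 ^ i) ^ DIM('a)) * ennreal ?M"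
      using emeasure_dilated_superlevel_le[of u "2 ^ i" t x] unfolding M by simp
    also have "\<dots> \<le> ennreal ((1 / 2) ^ i) * ennreal ?M"
    proof (intro mult_right_mono ennreal_leI)
      have "(2::real) ^ i \<le> (2 ^ i) ^ DIM('a)"
        using self_le_power[of "2 ^ i :: real" "DIM('a)"] by simp
      then show "1 / (2 ^ i) ^ DIM('a) \<le> (1 / 2 :: real) ^ i"
        by (simp add: power_one_over divide_simps)
    qed simp
    also have "\<dots> = ennreal ((1 / 2) ^ i * ?M)"
      by (rule ennreal_mult[symmetric]) auto
    finally show ?thesis .
  qed
  have "AE v in lborel. eventually (\<lambda>i. v \<in> space lborel - ?A i) sequentially"
  proof (rule borel_cantelli_AE1)
    show "?A i \<in> sets lborel" for i by measurable
    show f: "emeasure lborel (?A i) < \<infinity>" for i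
      using le[of i] by (rule le_less_trans) simp
    have "measure lborel (?A i) \<le> (1 / 2) ^ i * ?M" for i
      unfolding measure_def[of lborel "?A i"] using le[of i] by (intro enn2real_leI) auto
    then show "summable (\<lambda>i. measure lborel (?A i))"
      by (intro summable_comparison_test'[OF summable_mult2[OF summable_geometric[of "1 / 2 :: real"]], of 0]) auto
  qed
  then show ?thesis
    by (rule AE_mp) (intro AE_I2 impI, elim eventually_mono, auto simp: not_less)
qed

text \<open>A finite measure of all superlevel sets forbids \<open>u\<close> to have a nonzero limit along a set of
  rays of positive measure.\<close>

lemma AE_dyadic_dilation_limit_zero:
  fixes u :: "'a::euclidean_space \<Rightarrow> real"
  assumes [measurable]: "u \<in> borel_measurable borel"
    and fin: "\<And>t. t > 0 \<Longrightarrow> emeasure lborel {y. t < \<bar>u y\<bar>} < \<infinity>"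
  shows "AE v in lborel. norm v < 1 \<longrightarrow> (\<forall>L. (\<lambda>i. u (x + 2 ^ i *\<^sub>R v)) \<longlonglongrightarrow> L \<longrightarrow> L = 0)"
proof -
  have "AE v in lborel. \<forall>m. norm v < 1 \<longrightarrow> (\<forall>\<^sub>F i in sequentially. \<bar>u (x + 2 ^ i *\<^sub>R v)\<bar> \<le> 1 / real (Suc m))"
    unfolding AE_all_countable by (intro allI AE_dyadic_dilation_eventually_le fin) auto
  then show ?thesis
  proof (rule AE_mp, intro AE_I2 impI allI)
    fix v L
    assume ev: "\<forall>m. norm v < 1 \<longrightarrow> (\<forall>\<^sub>F i in sequentially. \<bar>u (x + 2 ^ i *\<^sub>R v)\<bar> \<le> 1 / real (Suc m))"
      and v: "norm v < 1" and L: "(\<lambda>i. u (x + 2 ^ i *\<^sub>R v)) \<longlonglongrightarrow> L"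
    have "\<bar>L\<bar> \<le> 1 / real (Suc m)" for m
      using tendsto_upperbound[OF tendsto_rabs[OF L] ev[rule_format, OF v, of m]] by simp
    then have "\<bar>L\<bar> \<le> 0"
      using LIMSEQ_le_const[OF LIMSEQ_inverse_real_of_nat, of "\<bar>L\<bar>"] by (simp add: inverse_eq_divide)
    then show "L = 0" by simp
  qed
qed

section \<open>The representation formula at a point\<close>

text \<open>The increment formula holds for each vector and almost every point; Fubini exchanges the two
  quantifiers, which is possible for countably many dilations at once.\<close>

lemma AE_dyadic_increment:
  fixes u :: "'a::euclidean_space \<Rightarrow> real" and g :: "'a \<Rightarrow> 'a"
  assumes meas[measurable]: "u \<in> borel_measurable borel" "g \<in> borel_measurable borel"
    and u: "\<And>\<rho>. set_integrable lborel (cball 0 \<rho>) u"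
    and g: "\<And>\<rho>. set_integrable lborel (cball 0 \<rho>) g"
    and weak: "\<And>\<phi> i. test_fun \<phi> \<Longrightarrow> i \<in> Basis \<Longrightarrow>
      (LINT x|lborel. u x * frechet_derivative \<phi> (at x) i) = - (LINT x|lborel. (g x \<bullet> i) * \<phi> x)"
  shows "AE x in lborel. AE v in lborel. \<forall>i::nat.
    u (x + 2 ^ i *\<^sub>R v) - u x = (LINT r|lborel. indicator {0..2 ^ i} r * (g (x + r *\<^sub>R v) \<bullet> v))"
    (is "AE x in lborel. AE v in lborel. \<forall>i. ?P i x v")
proof -
  have incr: "AE x in lborel. ?P i x v" for i v
  proof -
    have "AE x in lborel. u (x + 2 ^ i *\<^sub>R v) - u x =
        (LINT r|lborel. indicator {0..1} r * (g (x + r *\<^sub>R 2 ^ i *\<^sub>R v) \<bullet> 2 ^ i *\<^sub>R v))"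
      by (rule weak_gradient_difference[OF meas u g weak])
    moreover have "(LINT r|lborel. indicator {0..1} r * (g (x + r *\<^sub>R 2 ^ i *\<^sub>R v) \<bullet> 2 ^ i *\<^sub>R v)) =
        (LINT r|lborel. indicator {0..2 ^ i} r * (g (x + r *\<^sub>R v) \<bullet> v))" for x
    proof -
      have "(LINT r|lborel. indicator {0..2 ^ i} r * (g (x + r *\<^sub>R v) \<bullet> v)) =
        2 ^ i * (LINT r|lborel. indicator {0..2 ^ i} (0 + 2 ^ i * r) * (g (x + (0 + 2 ^ i * r) *\<^sub>R v) \<bullet> v))"
        by (subst lborel_integral_real_affine[of "2 ^ i" _ 0]) simp_all
      also have "\<dots> = (LINT r|lborel. 2 ^ i * (indicator {0..2 ^ i} (0 + 2 ^ i * r) * (g (x + (0 + 2 ^ i * r) *\<^sub>R v) \<bullet> v)))"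
        by (rule integral_mult_right_zero[symmetric])
      also have "\<dots> = (LINT r|lborel. indicator {0..1} r * (g (x + r *\<^sub>R 2 ^ i *\<^sub>R v) \<bullet> 2 ^ i *\<^sub>R v))"
        by (intro Bochner_Integration.integral_cong refl)
           (auto simp: indicator_def zero_le_mult_iff mult.commute power_le_zero_eq)
      finally show ?thesis by simp
    qed
    ultimately show ?thesis by simp
  qed
  have "AE v in lborel. AE x in lborel. \<forall>i. ?P i x v"
    unfolding AE_all_countable by (rule allI, rule AE_I2, rule incr)
  then show ?thesis
    by (subst lborel_pair.AE_commute) measurable
qed

text \<open>The increments converge to the integral over the whole ray, so \<open>u\<close> has a limit along the
  dyadic points of the ray, and that limit is 0.\<close>

lemma integral_along_ray_eq:
  fixes u :: "'a::euclidean_space \<Rightarrow> real" and g :: "'a \<Rightarrow> 'a"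
  assumes [measurable]: "g \<in> borel_measurable borel"
    and incr: "\<And>i::nat. u (x + 2 ^ i *\<^sub>R v) - u x = (LINT r|lborel. indicator {0..2 ^ i} r * (g (x + r *\<^sub>R v) \<bullet> v))"
    and decay: "\<And>L. (\<lambda>i. u (x + 2 ^ i *\<^sub>R v)) \<longlonglongrightarrow> L \<Longrightarrow> L = 0"
    and int: "integrable lborel (\<lambda>r. indicator {0<..} r * (g (x + r *\<^sub>R v) \<bullet> v))"
  shows "(LINT r|lborel. indicator {0<..} r * (g (x + r *\<^sub>R v) \<bullet> v)) = - u x"
proof -
  let ?j = "\<lambda>r. indicator {0<..} r * (g (x + r *\<^sub>R v) \<bullet> v)"
  have [measurable]: "?j \<in> borel_measurable borel" using int by auto
  have eq: "(LINT r|lborel. indicator {0..2 ^ i} r * (g (x + r *\<^sub>R v) \<bullet> v)) = (LINT r|lborel. indicator {..2 ^ i} r * ?j r)" for i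
    by (rule integral_cong_AE, measurable)
       (rule AE_mp[OF AE_lborel_singleton[of 0]], auto simp: indicator_def intro!: AE_I2)
  have "(\<lambda>i. LINT r|lborel. indicator {..2 ^ i} r * ?j r) \<longlonglongrightarrow> (LINT r|lborel. ?j r)"
  proof (rule integral_dominated_convergence[where w="\<lambda>r. norm (?j r)"])
    show "AE r in lborel. (\<lambda>i. indicator {..2 ^ i} r * ?j r) \<longlonglongrightarrow> ?j r"
    proof (rule AE_I2)
      fix r :: real
      obtain N where "r < 2 ^ N" using real_arch_pow[of 2 r] by auto
      then have "indicator {..2 ^ i} r * ?j r = ?j r" if "i \<ge> N" for i
      proof -
        have "r \<le> 2 ^ i"
          using power_increasing[OF that, of "2::real"] \<open>r < 2 ^ N\<close> by linarith
        then show ?thesis by simp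
      qed
      then show "(\<lambda>i. indicator {..2 ^ i} r * ?j r) \<longlonglongrightarrow> ?j r"
        by (intro tendsto_eventually) (auto simp: eventually_sequentially)
    qed
    show "AE r in lborel. norm (indicator {..2 ^ i} r * ?j r) \<le> norm (?j r)" for i
      by (intro AE_I2) (auto simp: indicator_def)
  qed (use int in \<open>auto simp del: real_norm_def\<close>)
  then have "(\<lambda>i. u x + (u (x + 2 ^ i *\<^sub>R v) - u x)) \<longlonglongrightarrow> u x + (LINT r|lborel. ?j r)"
    unfolding incr eq by (intro tendsto_intros)
  then have "u x + (LINT r|lborel. ?j r) = 0"
    by (intro decay) simp
  then show ?thesis by simp
qed

text \<open>For almost every \<open>v\<close> in the unit ball, the integral of \<open>g (x + r v) \<bullet> v\<close> over \<open>r > 0\<close> is \<open>- u x\<close>,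
  which does not depend on \<open>v\<close>.  Averaging over \<open>v\<close> and rewriting the left-hand side through
  \<open>w = r v\<close> produces the kernel \<open>w / norm w ^ n\<close>.\<close>

lemma representation_at_point:
  fixes u :: "'a::euclidean_space \<Rightarrow> real" and g :: "'a \<Rightarrow> 'a"
  assumes meas[measurable]: "u \<in> borel_measurable borel" "g \<in> borel_measurable borel"
    and riesz: "integrable lborel (\<lambda>w. norm (g (x + w)) / norm w ^ (DIM('a) - 1))"
    and incr: "AE v in lborel. \<forall>i::nat.
      u (x + 2 ^ i *\<^sub>R v) - u x = (LINT r|lborel. indicator {0..2 ^ i} r * (g (x + r *\<^sub>R v) \<bullet> v))"
    and fin: "\<And>t. t > 0 \<Longrightarrow> emeasure lborel {y. t < \<bar>u y\<bar>} < \<infinity>"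
  shows "integrable lborel (\<lambda>y. (g y \<bullet> (x - y)) / norm (x - y) ^ DIM('a))"
    and "u x = 1 / (DIM('a) * measure lborel (ball (0::'a) 1)) *
      (LINT y|lborel. (g y \<bullet> (x - y)) / norm (x - y) ^ DIM('a))"
proof -
  let ?n = "DIM('a)"
  define H where "H w = g (x + w) \<bullet> w" for w
  have H[measurable]: "H \<in> borel_measurable borel" unfolding H_def by measurable
  let ?J = "\<lambda>(v, r). (if norm v < 1 \<and> 0 < r then 1 / r else 0) * H (r *\<^sub>R v)"
  \<comment> \<open>\<open>g (x + w) \<bullet> w\<close> over \<open>norm w ^ n\<close> is dominated by the potential, by Cauchy-Schwarz.\<close>
  have iH: "integrable lborel (\<lambda>w. H w / norm w ^ ?n)"
  proof (rule Bochner_Integration.integrable_bound[OF riesz])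
    show "AE w in lborel. norm (H w / norm w ^ ?n) \<le> norm (norm (g (x + w)) / norm w ^ (?n - 1))"
    proof (rule AE_mp[OF AE_lborel_singleton[of 0]], intro AE_I2 impI)
      fix w :: 'a assume w: "w \<noteq> 0"
      have "norm w ^ ?n = norm w * norm w ^ (?n - 1)"
        using power_minus_mult[OF DIM_positive[where 'a='a], of "norm w"] by (simp add: mult.commute)
      moreover have "\<bar>H w\<bar> \<le> norm (g (x + w)) * norm w"
        unfolding H_def by (rule Cauchy_Schwarz_ineq2)
      ultimately show "norm (H w / norm w ^ ?n) \<le> norm (norm (g (x + w)) / norm w ^ (?n - 1))"
        using w by (simp add: divide_simps mult.commute)
    qed
  qed measurable
  have iH': "integrable lborel (\<lambda>w. H w / (?n * norm w ^ ?n))"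
    using integrable_divide_zero[of "real ?n" lborel, OF iH] by (simp add: mult.commute)
  have J: "integrable (lborel \<Otimes>\<^sub>M lborel) ?J"
    using iH' by (simp only: integrable_along_rays_iff[OF H])
  have ray: "?J (v, r) = indicator (ball 0 1) v * (indicator {0<..} r * (g (x + r *\<^sub>R v) \<bullet> v))" for v r
    by (auto simp: H_def indicator_def)
  have decay: "AE v in lborel. norm v < 1 \<longrightarrow> (\<forall>L. (\<lambda>i. u (x + 2 ^ i *\<^sub>R v)) \<longlonglongrightarrow> L \<longrightarrow> L = 0)"
    by (rule AE_dyadic_dilation_limit_zero[OF meas(1) fin])
  have ae: "AE v in lborel. (LINT r|lborel. ?J (v, r)) = - u x * indicator (ball 0 1) v"
    using lborel_pair.AE_integrable_fst'[OF J] incr decay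
  proof eventually_elim
    case (elim v)
    show ?case
    proof (cases "norm v < 1")
      case True
      have "integrable lborel (\<lambda>r. indicator {0<..} r * (g (x + r *\<^sub>R v) \<bullet> v))"
        using elim(1) True unfolding ray by simp
      then have "(LINT r|lborel. indicator {0<..} r * (g (x + r *\<^sub>R v) \<bullet> v)) = - u x"
        using elim(2,3) True by (intro integral_along_ray_eq meas(2)) auto
      then show ?thesis using True unfolding ray by simp
    next
      case False
      then show ?thesis unfolding ray by simp
    qed
  qed
  have "(LINT v|lborel. LINT r|lborel. ?J (v, r)) = (LINT v|lborel. - u x * indicator (ball (0::'a) 1) v)"
  proof (rule integral_cong_AE)
    show "(\<lambda>v. LINT r|lborel. ?J (v, r)) \<in> borel_measurable lborel"
      by (rule borel_measurable_integrable[OF lborel_pair.integrable_fst'[OF J]])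
    show "(\<lambda>v. - u x * indicator (ball (0::'a) 1) v) \<in> borel_measurable lborel"
      using borel_open[OF open_ball[of "0::'a" 1]] by measurable
  qed (rule ae)
  also have "\<dots> = - u x * measure lborel (ball (0::'a) 1)"
    by (subst integral_mult_right_zero) (simp add: measure_def)
  finally have "- u x * measure lborel (ball (0::'a) 1) = integral\<^sup>L (lborel \<Otimes>\<^sub>M lborel) ?J"
    unfolding lborel_pair.integral_fst'[OF J] by simp
  also have "\<dots> = (LINT w|lborel. (H w / norm w ^ ?n) / ?n)"
    unfolding integral_along_rays[OF H] by (simp add: mult.commute)
  also have "\<dots> = (LINT w|lborel. H w / norm w ^ ?n) / ?n"
    by (rule integral_divide_zero)
  finally have ux: "u x * measure lborel (ball (0::'a) 1) * ?n = - (LINT w|lborel. H w / norm w ^ ?n)"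
    by (simp add: field_simps)
  let ?K = "\<lambda>y. (g y \<bullet> (x - y)) / norm (x - y) ^ ?n"
  have K[measurable]: "?K \<in> borel_measurable borel" by measurable
  have KH: "?K (w + x) = - (H w / norm w ^ ?n)" for w
    by (simp add: H_def add.commute)
  have "integrable lborel (\<lambda>w. ?K (w + x))"
    unfolding KH using iH by simp
  then show "integrable lborel ?K"
    by (simp only: integral_lborel_translate(2)[OF K])
  have "(LINT y|lborel. ?K y) = (LINT w|lborel. ?K (w + x))"
    by (rule integral_lborel_translate(1)[OF K, symmetric])
  also have "\<dots> = - (LINT w|lborel. H w / norm w ^ ?n)"
    unfolding KH by simp
  finally have "(LINT y|lborel. ?K y) = u x * measure lborel (ball (0::'a) 1) * ?n"
    using ux by simp
  moreover have "measure lborel (ball (0::'a) 1) > 0"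
    using content_ball_pos[of 1 "0::'a"] by simp
  ultimately show "u x = 1 / (?n * measure lborel (ball (0::'a) 1)) * (LINT y|lborel. ?K y)"
    by simp
qed

section \<open>Borel representatives and the representation theorem\<close>

lemma completion_ex_borel_measurable_euclidean:
  fixes g :: "'a \<Rightarrow> 'b::euclidean_space"
  assumes "g \<in> borel_measurable (completion M)"
  shows "\<exists>g'\<in>borel_measurable M. AE x in M. g x = g' x"
proof -
  have "\<exists>h\<in>borel_measurable M. AE x in M. g x \<bullet> i = h x" for i
    using assms by (intro completion_ex_borel_measurable_real) auto
  then obtain h where h: "\<And>i. h i \<in> borel_measurable M" "\<And>i. AE x in M. g x \<bullet> i = h i x"
    by metis
  show ?thesis
  proof
    show "(\<lambda>x. \<Sum>i\<in>Basis. h i x *\<^sub>R i) \<in> borel_measurable M"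
      using h(1) by simp
    have "AE x in M. \<forall>i\<in>Basis. g x \<bullet> i = h i x"
      by (intro AE_finite_allI h(2)) simp
    then show "AE x in M. g x = (\<Sum>i\<in>Basis. h i x *\<^sub>R i)"
    proof (rule AE_mp, intro AE_I2 impI)
      fix x assume h: "\<forall>i\<in>Basis. g x \<bullet> i = h i x"
      have "g x = (\<Sum>i\<in>Basis. (g x \<bullet> i) *\<^sub>R i)" by (simp add: euclidean_representation)
      also have "\<dots> = (\<Sum>i\<in>Basis. h i x *\<^sub>R i)" using h by (intro sum.cong) auto
      finally show "g x = (\<Sum>i\<in>Basis. h i x *\<^sub>R i)" .
    qed
  qed
qed

lemma loc_integrable_borel_measurable:
  fixes f :: "'a::euclidean_space \<Rightarrow> 'b::euclidean_space"
  assumes "loc_integrable f"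
  shows "f \<in> borel_measurable lebesgue"
proof (rule borel_measurable_LIMSEQ_metric)
  show "(\<lambda>x. indicator (cball 0 (real i)) x *\<^sub>R f x) \<in> borel_measurable lebesgue" for i
    using assms compact_cball unfolding loc_integrable_def set_integrable_def
    by (blast intro: borel_measurable_integrable)
  fix x :: 'a
  obtain N where "norm x < real N" using reals_Archimedean2 by blast
  then have "\<forall>i\<ge>N. indicator (cball 0 (real i)) x *\<^sub>R f x = f x"
    by auto
  then show "(\<lambda>i. indicator (cball 0 (real i)) x *\<^sub>R f x) \<longlonglongrightarrow> f x"
    by (intro tendsto_eventually) (auto simp: eventually_sequentially)
qed

theorem lemma5p1:
  fixes u :: "'a::euclidean_space \<Rightarrow> real" and Du :: "'a \<Rightarrow> 'a"
  assumes "u \<in> W11_loc"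
    and "has_weak_gradient u Du"
    and "\<And>t. t > 0 \<Longrightarrow> emeasure lebesgue {x. \<bar>u x\<bar> > t} < \<infinity>"
    and "set_integrable lebesgue (- ball 0 1) (\<lambda>x. norm (Du x) / norm x ^ (DIM('a) - 1))"
  shows "AE x in lebesgue.
    integrable lebesgue (\<lambda>y. (Du y \<bullet> (x - y)) / norm (x - y) ^ DIM('a)) \<and>
    u x = 1 / (DIM('a) * measure lebesgue (ball (0::'a) 1)) *
      (LINT y|lebesgue. (Du y \<bullet> (x - y)) / norm (x - y) ^ DIM('a))"
proof -
  let ?n = "DIM('a)"
  have loc: "loc_integrable u" "loc_integrable Du"
    and weak: "\<And>\<phi> i. test_fun \<phi> \<Longrightarrow> i \<in> Basis \<Longrightarrow>
        (LINT x|lebesgue. u x * frechet_derivative \<phi> (at x) i) = - (LINT x|lebesgue. (Du x \<bullet> i) * \<phi> x)"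
    using assms(2) unfolding has_weak_gradient_def by auto
  \<comment> \<open>The weak gradient and all integrals depend only on classes modulo null sets, so Borel
    representatives may replace \<open>u\<close> and \<open>Du\<close>; joint measurability of \<open>g (x + r v)\<close> needs them.\<close>
  note um[measurable] = loc_integrable_borel_measurable[OF loc(1)]
    and Dm[measurable] = loc_integrable_borel_measurable[OF loc(2)]
  obtain u' where u'[measurable]: "u' \<in> borel_measurable borel" and "AE x in lborel. u x = u' x"
    using completion_ex_borel_measurable_real[OF um] by auto
  then have uu': "AE x in lebesgue. u x = u' x" by (simp add: AE_completion)
  obtain g where g[measurable]: "g \<in> borel_measurable borel" and "AE x in lborel. Du x = g x"
    using completion_ex_borel_measurable_euclidean[OF Dm] by auto
  then have Dg: "AE x in lebesgue. Du x = g x" by (simp add: AE_completion)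
  have [measurable]: "u' \<in> borel_measurable lebesgue" "g \<in> borel_measurable lebesgue"
    by (auto intro!: measurable_completion)
  have borel_sets[measurable]: "cball (0::'a) \<rho> \<in> sets borel" "- ball (0::'a) 1 \<in> sets borel" for \<rho>
    by auto
  have [measurable]: "cball (0::'a) \<rho> \<in> sets lebesgue" "- ball (0::'a) 1 \<in> sets lebesgue" for \<rho>
    using borel_sets by (auto intro!: sets_completionI_sets)
  have [measurable]: "norm \<in> borel_measurable lebesgue"
    by (rule measurable_completion) simp
  have locu': "set_integrable lborel (cball 0 \<rho>) u'" for \<rho>
  proof -
    have "integrable lebesgue (\<lambda>x. indicator (cball 0 \<rho>) x *\<^sub>R u x)"
      using loc(1) unfolding loc_integrable_def set_integrable_def by auto
    also have "integrable lebesgue (\<lambda>x. indicator (cball 0 \<rho>) x *\<^sub>R u x) \<longleftrightarrow> integrable lebesgue (\<lambda>x. indicator (cball 0 \<rho>) x *\<^sub>R u' x)"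
      by (intro integrable_cong_AE) (use uu' in \<open>auto elim: eventually_mono\<close>)
    finally show ?thesis
      unfolding set_integrable_def by (subst (asm) integrable_completion) auto
  qed
  have locg: "set_integrable lborel (cball 0 \<rho>) g" for \<rho>
  proof -
    have "integrable lebesgue (\<lambda>x. indicator (cball 0 \<rho>) x *\<^sub>R Du x)"
      using loc(2) unfolding loc_integrable_def set_integrable_def by auto
    also have "integrable lebesgue (\<lambda>x. indicator (cball 0 \<rho>) x *\<^sub>R Du x) \<longleftrightarrow> integrable lebesgue (\<lambda>x. indicator (cball 0 \<rho>) x *\<^sub>R g x)"
      by (intro integrable_cong_AE) (use Dg in \<open>auto elim: eventually_mono\<close>)
    finally show ?thesis
      unfolding set_integrable_def by (subst (asm) integrable_completion) auto
  qed
  have far: "set_integrable lborel (- ball 0 1) (\<lambda>x. norm (g x) / norm x ^ (?n - 1))"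
  proof -
    note assms(4)[unfolded set_integrable_def]
    also have "integrable lebesgue (\<lambda>x. indicator (- ball 0 1) x *\<^sub>R (norm (Du x) / norm x ^ (?n - 1))) \<longleftrightarrow>
        integrable lebesgue (\<lambda>x. indicator (- ball 0 1) x *\<^sub>R (norm (g x) / norm x ^ (?n - 1)))"
      by (intro integrable_cong_AE) (use Dg in \<open>auto elim: eventually_mono\<close>)
    finally show ?thesis
      unfolding set_integrable_def by (subst (asm) integrable_completion) auto
  qed
  have weak': "(LINT x|lborel. u' x * frechet_derivative \<phi> (at x) i) = - (LINT x|lborel. (g x \<bullet> i) * \<phi> x)"
    if \<phi>: "test_fun \<phi>" and i: "i \<in> Basis" for \<phi> i
  proof -
    note [measurable] = test_fun_measurable[OF \<phi>] test_fun_measurable[OF test_fun_frechet_derivative[OF \<phi>, of i]]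
    have [measurable]: "\<phi> \<in> borel_measurable lebesgue" "(\<lambda>x. frechet_derivative \<phi> (at x) i) \<in> borel_measurable lebesgue"
      by (auto intro!: measurable_completion)
    have "(LINT x|lborel. u' x * frechet_derivative \<phi> (at x) i) = (LINT x|lebesgue. u' x * frechet_derivative \<phi> (at x) i)"
      by (rule integral_completion[symmetric]) simp
    also have "\<dots> = (LINT x|lebesgue. u x * frechet_derivative \<phi> (at x) i)"
      by (intro integral_cong_AE) (use uu' in \<open>auto elim: eventually_mono\<close>)
    also have "\<dots> = - (LINT x|lebesgue. (Du x \<bullet> i) * \<phi> x)" by (rule weak[OF \<phi> i])
    also have "(LINT x|lebesgue. (Du x \<bullet> i) * \<phi> x) = (LINT x|lebesgue. (g x \<bullet> i) * \<phi> x)"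
      by (intro integral_cong_AE) (use Dg in \<open>auto elim: eventually_mono\<close>)
    also have "\<dots> = (LINT x|lborel. (g x \<bullet> i) * \<phi> x)"
      by (rule integral_completion) simp
    finally show ?thesis .
  qed
  have fin: "emeasure lborel {y. t < \<bar>u' y\<bar>} < \<infinity>" if "t > 0" for t
  proof -
    have "emeasure lborel {y. t < \<bar>u' y\<bar>} = emeasure lebesgue {y. t < \<bar>u' y\<bar>}"
      by simp
    also have "\<dots> = emeasure lebesgue {y. t < \<bar>u y\<bar>}"
    proof (rule emeasure_eq_AE)
      show "{y. t < \<bar>u' y\<bar>} \<in> sets lebesgue" "{y. t < \<bar>u y\<bar>} \<in> sets lebesgue"
        using borel_measurable_less[of "\<lambda>_. t" lebesgue "\<lambda>y. \<bar>u' y\<bar>"] borel_measurable_less[of "\<lambda>_. t" lebesgue "\<lambda>y. \<bar>u y\<bar>"]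
        by simp_all
    qed (use uu' in \<open>auto elim: eventually_mono\<close>)
    also have "\<dots> < \<infinity>" by (rule assms(3)[OF that])
    finally show ?thesis .
  qed
  have incr: "AE x in lborel. AE v in lborel. \<forall>i::nat.
      u' (x + 2 ^ i *\<^sub>R v) - u' x = (LINT r|lborel. indicator {0..2 ^ i} r * (g (x + r *\<^sub>R v) \<bullet> v))"
    by (rule AE_dyadic_increment[OF u' g locu' locg weak'])
  have "AE x in lborel. integrable lborel (\<lambda>y. (g y \<bullet> (x - y)) / norm (x - y) ^ ?n) \<and>
      u' x = 1 / (?n * measure lborel (ball (0::'a) 1)) * (LINT y|lborel. (g y \<bullet> (x - y)) / norm (x - y) ^ ?n)"
    using AE_integrable_riesz_potential[OF g locg far] incr
  proof eventually_elim
    case (elim x)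
    then show ?case using representation_at_point[OF u' g _ _ fin] by blast
  qed
  then have "AE x in lebesgue. integrable lborel (\<lambda>y. (g y \<bullet> (x - y)) / norm (x - y) ^ ?n) \<and>
      u' x = 1 / (?n * measure lborel (ball (0::'a) 1)) * (LINT y|lborel. (g y \<bullet> (x - y)) / norm (x - y) ^ ?n)"
    by (rule AE_completion)
  then show ?thesis
    using uu'
  proof eventually_elim
    case (elim x)
    let ?K = "\<lambda>h y. (h y \<bullet> (x - y)) / norm (x - y) ^ ?n"
    have ae: "AE y in lebesgue. ?K Du y = ?K g y"
      using Dg by (auto elim: eventually_mono)
    have Kg[measurable]: "?K g \<in> borel_measurable borel" by measurable
    have [measurable]: "(\<lambda>y. x - y) \<in> borel_measurable lebesgue"
      by (rule measurable_completion) simp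
    have m: "?K Du \<in> borel_measurable lebesgue" "?K g \<in> borel_measurable lebesgue"
      by measurable
    have "integrable lebesgue (?K Du) \<longleftrightarrow> integrable lebesgue (?K g)"
      by (rule integrable_cong_AE[OF m ae])
    also have "\<dots> \<longleftrightarrow> integrable lborel (?K g)" by (rule integrable_completion) simp
    finally have 1: "integrable lebesgue (?K Du) \<longleftrightarrow> integrable lborel (?K g)" .
    have "(LINT y|lebesgue. ?K Du y) = (LINT y|lebesgue. ?K g y)"
      by (rule integral_cong_AE[OF m ae])
    also have "\<dots> = (LINT y|lborel. ?K g y)" by (rule integral_completion) simp
    finally have 2: "(LINT y|lebesgue. ?K Du y) = (LINT y|lborel. ?K g y)" .
    have 3: "measure lebesgue (ball (0::'a) 1) = measure lborel (ball (0::'a) 1)"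
      by (simp add: measure_def)
    show ?case using elim unfolding 1 2 3 by simp
  qed
qed

end
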